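(* Let $W$ be either the symmetric group $\mathfrak{S}_n$ (with simple generators the adjacent transpositions $s_i=(i\ i+1)$, $1\le i\le n-1$) or the hyperoctahedral group $B_n$ (with simple generators $t_{i,i+1}=(i\ i+1)(-i\ -(i+1))$ for $1\le i\le n-1$ together with $t_{1,-1}=(1\ -1)$). Then the Cayley graph $\mathrm{Cay}(W)$ has the strong hull property: for all $u,v,w\in W$, \[ |\mathrm{conv}(u,v)|\cdot|\mathrm{conv}(v,w)|\ \ge\ |\mathrm{conv}(u,v,w)|. \]
   Context: For a Coxeter group $W$ with simple reflections $S$, $\mathrm{Cay}(W)$ is the undirected Cayley graph of $W$ with respect to $S$ (vertices $W$, with $x$ adjacent to $xs$ for $s\in S$). For a connected graph $G$ with shortest-path distance $d$, a set $C\subseteq V(G)$ is convex if whenever $u,v\in C$ and $d(u,w)+d(w,v)=d(u,v)$ we have $w\in C$; for $X\subseteq V(G)$, $\mathrm{conv}(X)$ is the intersection of all convex sets containing $X$, and $\mathrm{conv}(x_1,\dots,x_d)=\mathrm{conv}(\{x_1,\dots,x_d\})$. $B_n$ is the group of permutations $w$ of $\{\pm1,\dots,\pm n\}$ with $w(-i)=-w(i)$ for all $i$. *)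

theory Defs
  imports "HOL-Algebra.Sym_Groups" "Graph_Theory.Graph_Theory"
begin

text \<open>Graphs are symmetric digraphs. The distance is the library's weighted shortest-path
  distance \<open>wf_digraph.\<mu>\<close>, with all arcs of weight 1; it takes values in \<^typ>\<open>ereal\<close> and is finite
  between any two vertices of a connected graph.\<close>

definition graph_dist :: "('a, 'b) pre_digraph \<Rightarrow> 'a \<Rightarrow> 'a \<Rightarrow> ereal" where
  "graph_dist G u v = wf_digraph.\<mu> G (\<lambda>_. 1) u v"

definition graph_convex :: "('a, 'b) pre_digraph \<Rightarrow> 'a set \<Rightarrow> bool" where
  "graph_convex G C \<longleftrightarrow> C \<subseteq> verts G \<and>
     (\<forall>u\<in>C. \<forall>v\<in>C. \<forall>w\<in>verts G.
        graph_dist G u w + graph_dist G w v = graph_dist G u v \<longrightarrow> w \<in> C)"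

definition graph_conv :: "('a, 'b) pre_digraph \<Rightarrow> 'a set \<Rightarrow> 'a set" where
  "graph_conv G X = \<Inter> {C. graph_convex G C \<and> X \<subseteq> C}"

definition strong_hull_property :: "('a, 'b) pre_digraph \<Rightarrow> bool" where
  "strong_hull_property G \<longleftrightarrow>
     (\<forall>u\<in>verts G. \<forall>v\<in>verts G. \<forall>w\<in>verts G.
        card (graph_conv G {u, v}) * card (graph_conv G {v, w}) \<ge> card (graph_conv G {u, v, w}))"

definition cayley_graph :: "('a, 'm) monoid_scheme \<Rightarrow> 'a set \<Rightarrow> ('a, 'a \<times> 'a) pre_digraph" where
  "cayley_graph W S = with_proj
     \<lparr> pverts = carrier W,
       parcs = {(x, y). x \<in> carrier W \<and> y \<in> carrier W \<and>
                        (\<exists>s\<in>S. y = x \<otimes>\<^bsub>W\<^esub> s \<or> x = y \<otimes>\<^bsub>W\<^esub> s)} \<rparr>"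

lemma wf_digraph_cayley_graph: "wf_digraph (cayley_graph W S)"
  by unfold_locales (auto simp: cayley_graph_def)

lemma symmetric_cayley_graph: "symmetric (cayley_graph W S)"
  by (auto simp: cayley_graph_def symmetric_def sym_def)

definition sym_group_gens :: "nat \<Rightarrow> (nat \<Rightarrow> nat) set" where
  "sym_group_gens n = {transpose i (i + 1) | i. 1 \<le> i \<and> i < n}"

text \<open>As in \<^const>\<open>sym_group\<close>, the group elements are functions on the whole type that
  are the identity outside \<open>{\<plusminus>1, \<dots>, \<plusminus>n}\<close>.\<close>

definition hyperoctahedral_group :: "nat \<Rightarrow> (int \<Rightarrow> int) monoid" where
  "hyperoctahedral_group n =
     \<lparr> carrier = {w. w permutes ({- int n..int n} - {0}) \<and>
                      (\<forall>i \<in> {- int n..int n} - {0}. w (- i) = - w i)},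
       mult = (\<circ>), one = id \<rparr>"

lemma group_hyperoctahedral_group: "group (hyperoctahedral_group n)"
proof (rule groupI, goal_cases)
  case (1 x y)
  then have "y i \<in> {- int n..int n} - {0}" if "i \<in> {- int n..int n} - {0}" for i
    using that permutes_in_image[of y] unfolding hyperoctahedral_group_def by fastforce
  with 1 show ?case
    by (auto simp: hyperoctahedral_group_def intro: permutes_compose)
next
  case (5 x)
  let ?A = "{- int n..int n} - {0}"
  from 5 have p: "x permutes ?A" and o: "\<And>i. i \<in> ?A \<Longrightarrow> x (- i) = - x i"
    by (auto simp: hyperoctahedral_group_def)
  have "inv_into UNIV x (- i) = - inv_into UNIV x i" if "i \<in> ?A" for i
  proof -
    have "inv_into UNIV x i \<in> ?A"
      using that permutes_in_image[OF permutes_inv[OF p]] by blast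
    then have "x (- inv_into UNIV x i) = - i"
      using o permutes_inverses(1)[OF p] by simp
    then show ?thesis
      using permutes_inverses(2)[OF p] by metis
  qed
  then have "inv_into UNIV x \<in> carrier (hyperoctahedral_group n)"
    using permutes_inv[OF p] by (simp add: hyperoctahedral_group_def)
  moreover have "inv_into UNIV x \<otimes>\<^bsub>hyperoctahedral_group n\<^esub> x = \<one>\<^bsub>hyperoctahedral_group n\<^esub>"
    by (simp add: hyperoctahedral_group_def permutes_inv_o(2)[OF p])
  ultimately show ?case by blast
qed (auto simp: hyperoctahedral_group_def permutes_id comp_assoc)

text \<open>The case distinction only concerns the trivial group for \<open>n = 0\<close>, which does not
  contain the transposition of \<open>1\<close> and \<open>-1\<close>.\<close>

definition hyperoctahedral_group_gens :: "nat \<Rightarrow> (int \<Rightarrow> int) set" where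
  "hyperoctahedral_group_gens n =
     {transpose i (i + 1) \<circ> transpose (- i) (- (i + 1)) | i. 1 \<le> i \<and> i < int n} \<union>
     (if n = 0 then {} else {transpose 1 (- 1)})"

lemma sym_group_gens_subset: "sym_group_gens n \<subseteq> carrier (sym_group n)"
  by (auto simp: sym_group_gens_def sym_group_def intro!: permutes_swap_id)

lemma hyperoctahedral_group_gens_subset:
  "hyperoctahedral_group_gens n \<subseteq> carrier (hyperoctahedral_group n)"
proof
  fix s assume "s \<in> hyperoctahedral_group_gens n"
  then consider i where "s = transpose i (i + 1) \<circ> transpose (- i) (- (i + 1))" "1 \<le> i" "i < int n"
    | "s = transpose 1 (- 1)" "n \<noteq> 0"
    by (auto simp: hyperoctahedral_group_gens_def split: if_splits)
  then show "s \<in> carrier (hyperoctahedral_group n)"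
  proof cases
    case 1
    then have "s permutes ({- int n..int n} - {0})"
      by (auto intro!: permutes_compose permutes_swap_id)
    moreover have "s (- j) = - s j" for j
      using 1 by (auto simp: transpose_def)
    ultimately show ?thesis by (simp add: hyperoctahedral_group_def)
  next
    case 2
    then have "s permutes ({- int n..int n} - {0})"
      by (auto intro!: permutes_swap_id)
    moreover have "s (- j) = - s j" for j
      using 2 by (auto simp: transpose_def)
    ultimately show ?thesis by (simp add: hyperoctahedral_group_def)
  qed
qed

end

theory Submission
  imports Defs
begin

text \<open>A convex hull in the Cayley graph is governed by pairs of letters: an element \<open>z\<close> lies in
  \<open>conv(u, v)\<close> as soon as every pair ordered the same way in \<open>u\<close> and \<open>v\<close> is ordered that way in
  \<open>z\<close>, and elements of \<open>conv(u, v, w)\<close> satisfy the analogous condition. For type B this asks to show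
  \<open>e(P) e(Q) \<ge> e(P \<inter> Q)\<close>, where \<open>P\<close> and \<open>Q\<close> are partial orders on \<open>{\<plusminus>1, \<dots>, \<plusminus>n}\<close> that are stable under
  \<open>(a, b) \<mapsto> (- b, - a)\<close> and contained in a common total order, and \<open>e\<close> counts the symmetric linear
  extensions.

  Write \<open>P - x\<close> for the restriction of \<open>P\<close> to the complement of \<open>{x, - x}\<close>. Toggles (Bender--Knuth
  involutions) move a letter through a symmetric linear extension along a promotion path. The letters
  on it form a \<open>P\<close>-chain, and since toggles are bijections, at least \<open>e(P - x)\<close> extensions have \<open>x\<close>
  on their path. Hence \<open>\<Sum>\<^sub>x g(x) e(P - x) \<le> K e(P)\<close> whenever \<open>K\<close> bounds the sum of \<open>g\<close> over every
  \<open>P\<close>-chain. Let \<open>M\<close> be the set of maximal elements of \<open>P \<inter> Q\<close>. A \<open>P\<close>-chain inside \<open>M\<close> is a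
  \<open>Q\<close>-antichain, so it meets a \<open>Q\<close>-chain at most once, and the inequality for \<open>Q\<close> bounds the sum of
  \<open>e(Q - x)\<close> over it by \<open>e(Q)\<close>. The inequality for \<open>P\<close> then gives
  \<open>e(P) e(Q) \<ge> \<Sum>\<^sub>x e(P - x) e(Q - x)\<close> over \<open>x \<in> M\<close>, and by induction this is at least
  \<open>\<Sum>\<^sub>x e((P \<inter> Q) - x) \<ge> e(P \<inter> Q)\<close>.\<close>

section \<open>Symmetric linear extensions\<close>

definition sym_order :: "(int \<times> int) set \<Rightarrow> bool" where
  "sym_order P \<longleftrightarrow> irrefl P \<and> trans P \<and> (\<forall>a b. (a, b) \<in> P \<longrightarrow> (- b, - a) \<in> P)"

text \<open>The condition \<open>rev xs = map uminus xs\<close> is \<open>w(-i) = -w(i)\<close> for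
  the word of a signed permutation. The sorting condition only forbids inversions of
  \<open>P\<close>; unrelated letters may come in either order.\<close>

definition sym_words :: "int set \<Rightarrow> (int \<times> int) set \<Rightarrow> int list set" where
  "sym_words V P =
     {xs. distinct xs \<and> set xs = V \<and> rev xs = map uminus xs \<and> sorted_wrt (\<lambda>a b. (b, a) \<notin> P) xs}"

lemma sym_orderD:
  assumes "sym_order P"
  shows "(a, a) \<notin> P" "(a, b) \<in> P \<Longrightarrow> (b, c) \<in> P \<Longrightarrow> (a, c) \<in> P"
    "(a, b) \<in> P \<Longrightarrow> (- b, - a) \<in> P"
  using assms unfolding sym_order_def irrefl_def trans_def by blast+

lemma sym_order_Int: "sym_order P \<Longrightarrow> sym_order Q \<Longrightarrow> sym_order (P \<inter> Q)"
  unfolding sym_order_def by (auto simp: irrefl_def trans_Int)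

lemma finite_sym_words: "finite V \<Longrightarrow> finite (sym_words V P)"
  by (rule finite_subset[OF _ finite_subset_distinct[of V]]) (auto simp: sym_words_def)

lemma sym_words_nth_mirror:
  assumes "xs \<in> sym_words V P" "i < length xs"
  shows "xs ! (length xs - Suc i) = - xs ! i"
proof -
  have "rev xs ! i = map uminus xs ! i" using assms(1) by (simp add: sym_words_def)
  then show ?thesis using assms(2) by (simp add: rev_nth)
qed

lemma even_length_sym_words:
  assumes "xs \<in> sym_words V P" "0 \<notin> V"
  shows "even (length xs)"
proof (rule ccontr)
  assume "odd (length xs)"
  then obtain m where m: "length xs = 2 * m + 1" by (elim oddE)
  have "xs ! m = - xs ! m" using sym_words_nth_mirror[OF assms(1), of m] m by simp
  then have "xs ! m = 0" by simp
  moreover have "xs ! m \<in> V" using assms(1) m nth_mem[of m xs] by (auto simp: sym_words_def)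
  ultimately show False using assms(2) by simp
qed

lemma sym_words_half:
  assumes "xs \<in> sym_words V P" "0 \<notin> V"
  obtains ws where "xs = map uminus (rev ws) @ ws"
proof -
  obtain m where m: "length xs = 2 * m" using even_length_sym_words[OF assms] by (elim evenE)
  have "take m xs = map uminus (rev (drop m xs))"
  proof -
    have "take m xs = rev (drop m (rev xs))" using m by (simp add: drop_rev)
    also have "rev xs = map uminus xs" using assms(1) by (simp add: sym_words_def)
    finally show ?thesis by (simp add: drop_map rev_map)
  qed
  then have "xs = map uminus (rev (drop m xs)) @ drop m xs" by (metis append_take_drop_id)
  then show ?thesis by (rule that)
qed

text \<open>Constraints inside the left half are mirror images of those inside the right half
  \<open>ws\<close>, so only the latter and those between the halves remain.\<close>

lemma sorted_wrt_mirror: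
  assumes "sym_order P"
  shows "sorted_wrt (\<lambda>a b. (b, a) \<notin> P) (map uminus (rev ws) @ ws) \<longleftrightarrow>
     sorted_wrt (\<lambda>a b. (b, a) \<notin> P) ws \<and> (\<forall>a\<in>set ws. \<forall>b\<in>set ws. (b, - a) \<notin> P)"
proof -
  have "(- a, - b) \<in> P \<longleftrightarrow> (b, a) \<in> P" for a b
    using sym_orderD(3)[OF assms] by (metis minus_minus)
  then show ?thesis
    by (auto simp: sorted_wrt_append sorted_wrt_map sorted_wrt_rev)
qed

lemma mirror_in_sym_words:
  assumes "sym_order P"
  shows "map uminus (rev ws) @ ws \<in> sym_words V P \<longleftrightarrow>
     distinct (map uminus (rev ws) @ ws) \<and> set ws \<union> uminus ` set ws = V \<and>
     sorted_wrt (\<lambda>a b. (b, a) \<notin> P) ws \<and> (\<forall>a\<in>set ws. \<forall>b\<in>set ws. (b, - a) \<notin> P)"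
  unfolding sym_words_def mem_Collect_eq sorted_wrt_mirror[OF assms]
  by (auto simp: rev_map o_def)

text \<open>Deleting \<open>x\<close> and \<open>- x\<close> from a symmetric linear extension can be undone by putting
  \<open>x\<close> back as far to the left as \<open>P\<close> allows; the words that arise in this way are those satisfying the
  following predicate.\<close>

definition lower_adjacent :: "(int \<times> int) set \<Rightarrow> int \<Rightarrow> int list \<Rightarrow> bool" where
  "lower_adjacent P x xs \<longleftrightarrow>
     (\<exists>j<length xs. xs ! j = x \<and> (j = 0 \<or> (xs ! (j - 1), x) \<in> P))"

lemma lower_adjacentI:
  "lower_adjacent P x (x # ys)"
  "(d, x) \<in> P \<Longrightarrow> lower_adjacent P x (us @ d # x # ys)"
  unfolding lower_adjacent_def
   apply force
  apply (rule exI[of _ "Suc (length us)"])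
  apply (simp add: nth_append)
  done

text \<open>The place for \<open>x\<close> is right after the last letter below it in
  \<open>P\<close>, or the front of the word if there is none. Symmetry is kept by working in the
  right half \<open>ws\<close>, which receives either \<open>x\<close> or
  \<open>- x\<close>.\<close>

lemma ex_insertion:
  assumes P: "sym_order P" and V: "0 \<notin> V" "x \<in> V" "- x \<in> V"
    and b: "b \<in> sym_words (V - {x, - x}) P"
  obtains y where "y \<in> sym_words V P" "lower_adjacent P x y" "filter (\<lambda>z. z \<notin> {x, - x}) y = b"
proof -
  note ord = sym_orderD[OF P] and res = that
  have x0: "x \<noteq> - x" using V by auto
  obtain ws where bws: "b = map uminus (rev ws) @ ws"
    using sym_words_half[OF b] V(1) by auto
  have ws: "distinct (map uminus (rev ws) @ ws)" "set ws \<union> uminus ` set ws = V - {x, - x}"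
    and srt: "sorted_wrt (\<lambda>a b. (b, a) \<notin> P) ws"
    and cross: "\<And>a b. a \<in> set ws \<Longrightarrow> b \<in> set ws \<Longrightarrow> (b, - a) \<notin> P"
    using b unfolding bws mirror_in_sym_words[OF P] by blast+
  have notin: "x \<notin> set ws" "- x \<notin> set ws" using ws(2) by auto
  have fil: "filter (\<lambda>z. z \<notin> {x, - x}) (map uminus (rev ws) @ ws) = b"
    unfolding bws using ws(2) by (intro filter_True) (auto simp: set_eq_iff)
  have neg: "(a, - b) \<in> P \<longleftrightarrow> (b, - a) \<in> P" "(- a, b) \<in> P \<longleftrightarrow> (- b, a) \<in> P" for a b
    using ord(3) by (metis minus_minus)+
  have Veq: "V = insert x (insert (- x) (set ws \<union> uminus ` set ws))" using ws(2) V by auto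
  \<comment> \<open>The checks common to all placements: \<open>hs\<close> is \<open>ws\<close> with
    \<open>z\<close> inserted, and the new constraints between the halves are those involving
    \<open>z\<close>.\<close>
  have build: thesis
    if hs: "hs = us @ z # vs" "ws = us @ vs" "z = x \<or> z = - x"
      and srt': "sorted_wrt (\<lambda>a b. (b, a) \<notin> P) hs"
      and crz: "\<And>b. b \<in> set ws \<Longrightarrow> (b, - z) \<notin> P" "(z, - z) \<notin> P"
      and low: "lower_adjacent P x (map uminus (rev hs) @ hs)" for hs us vs z
  proof (rule res)
    have "distinct (map uminus (rev hs) @ hs)"
      using ws(1) notin hs x0 unfolding hs(2)
      by (auto simp: image_iff distinct_map inj_on_def)
    moreover have "set hs \<union> uminus ` set hs = V"
      using hs unfolding Veq by auto
    moreover have "\<forall>a\<in>set hs. \<forall>b\<in>set hs. (b, - a) \<notin> P"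
      using cross crz neg hs by auto
    ultimately show "map uminus (rev hs) @ hs \<in> sym_words V P"
      using srt' by (simp only: mirror_in_sym_words[OF P] simp_thms)
    show "filter (\<lambda>z. z \<notin> {x, - x}) (map uminus (rev hs) @ hs) = b"
      using hs(3) unfolding hs(1) fil[symmetric] hs(2) by auto
  qed (fact low)
  show thesis
  \<comment> \<open>The cases ask where the last letter below \<open>x\<close> stands: in the right
    half, at \<open>- x\<close> itself, in the left half, or nowhere.\<close>
  proof (cases "\<exists>d\<in>set ws. (d, x) \<in> P")
    case True
    then obtain us d vs where s: "ws = us @ d # vs" "(d, x) \<in> P" "\<forall>e\<in>set vs. (e, x) \<notin> P"
      using split_list_last_prop[of ws "\<lambda>d. (d, x) \<in> P"] by blast
    have d: "d \<in> set ws" using s by simp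
    show thesis
    proof (rule build[of "(us @ [d]) @ x # vs" "us @ [d]" x vs])
      show "sorted_wrt (\<lambda>a b. (b, a) \<notin> P) ((us @ [d]) @ x # vs)"
      proof -
        \<comment> \<open>If \<open>x\<close> were below \<open>e\<close>, then \<open>d\<close>
          would be below \<open>e\<close>, which stands no later than \<open>d\<close>.\<close>
        have "(x, e) \<notin> P" if "e \<in> insert d (set us)" for e
          using that srt ord(1)[of d] ord(2)[OF s(2), of e] unfolding s(1) sorted_wrt_append by auto
        then show ?thesis using srt s(3) unfolding s(1) by (auto simp: sorted_wrt_append)
      qed
      \<comment> \<open>By symmetry, \<open>b\<close> below \<open>- x\<close> means
        \<open>x\<close> below \<open>- b\<close>, hence \<open>d\<close> below \<open>- b\<close>,
        against \<open>cross\<close>.\<close>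
      show "(b, - x) \<notin> P" if "b \<in> set ws" for b
        using cross[OF that d] neg(1)[of b x] ord(2)[OF s(2)] by blast
      show "(x, - x) \<notin> P"
        using cross[OF d d] ord(2)[OF s(2)] ord(3)[OF s(2)] ord(2) by blast
      show "lower_adjacent P x (map uminus (rev ((us @ [d]) @ x # vs)) @ (us @ [d]) @ x # vs)"
        using lower_adjacentI(2)[OF s(2), of "map uminus (rev ((us @ [d]) @ x # vs)) @ us" vs]
        by simp
    qed (use s in auto)
  next
    case no: False
    show thesis
    proof (cases "(- x, x) \<in> P")
      case True
      show thesis
      proof (rule build[of "x # ws" "[]" x ws])
        show "(b, - x) \<notin> P" if "b \<in> set ws" for b
          using no that ord(2)[OF _ True, of b] by blast
        show "(x, - x) \<notin> P" using ord True by blast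
        show "lower_adjacent P x (map uminus (rev (x # ws)) @ x # ws)"
          using lower_adjacentI(2)[OF True, of "map uminus (rev ws)" ws] by simp
      qed (use no srt in auto)
    next
      case nx: False
      show thesis
      proof (cases "\<exists>a\<in>set ws. (- x, a) \<in> P")
        case True
        \<comment> \<open>Mirrored, \<open>- x\<close> just before the first such \<open>a\<close>
          becomes \<open>x\<close> just after \<open>- a\<close>, the last letter below
          \<open>x\<close>.\<close>
        then obtain us a vs where s: "ws = us @ a # vs" "(- x, a) \<in> P" "\<forall>e\<in>set us. (- x, e) \<notin> P"
          using split_list_first_prop[of ws "\<lambda>d. (- x, d) \<in> P"] by blast
        show thesis
        proof (rule build[of "us @ (- x) # a # vs" us "- x" "a # vs"])
          show "sorted_wrt (\<lambda>a b. (b, a) \<notin> P) (us @ (- x) # a # vs)"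
          proof -
            have "(e, - x) \<notin> P" if "e \<in> insert a (set vs)" for e
              using that srt ord(1)[of a] ord(2)[OF _ s(2), of e] unfolding s(1) sorted_wrt_append by auto
            then show ?thesis using srt s(3) unfolding s(1) by (auto simp: sorted_wrt_append)
          qed
          show "lower_adjacent P x (map uminus (rev (us @ (- x) # a # vs)) @ us @ (- x) # a # vs)"
            using lower_adjacentI(2)[of "- a" x P "map uminus (rev vs)"] s(2) neg(2)[of x a] by simp
        qed (use s no nx in auto)
      next
        case False
        show thesis
        proof (rule build[of "ws @ [- x]" ws "- x" "[]"])
          show "lower_adjacent P x (map uminus (rev (ws @ [- x])) @ ws @ [- x])"
            using lower_adjacentI(1) by simp
        qed (use no nx False srt in \<open>auto simp: sorted_wrt_append\<close>)
      qed
    qed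
  qed
qed

section \<open>Toggles and promotion paths\<close>

text \<open>For \<open>l = 2 * k + 2\<close> the two exchanged pairs of positions coincide, and this is the
  single transposition of the two middle positions.\<close>

definition mirror_swap :: "nat \<Rightarrow> nat \<Rightarrow> nat \<Rightarrow> nat" where
  "mirror_swap l k i =
     (if i = k then Suc k else if i = Suc k then k
      else if i = l - Suc k then l - Suc (Suc k) else if i = l - Suc (Suc k) then l - Suc k else i)"

context
  fixes l k :: nat
  assumes l: "even l" "Suc k < l"
begin

text \<open>As \<open>l\<close> is even, the two exchanged pairs of positions are disjoint or equal;
  they never share just one position.\<close>

lemma not_middle: "l - Suc k \<noteq> k" "l - Suc (Suc k) \<noteq> Suc k" "l - Suc k = Suc k \<longleftrightarrow> l - Suc (Suc k) = k"
  using l by presburger+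

lemma mirror_swap_simps:
  shows "mirror_swap l k k = Suc k" "mirror_swap l k (Suc k) = k"
    and "mirror_swap l k (mirror_swap l k i) = i"
    and "i < l \<Longrightarrow> mirror_swap l k i < l"
  using l not_middle unfolding mirror_swap_def by auto

lemma mirror_swap_permutes: "mirror_swap l k permutes {..<l}"
proof (rule bij_imp_permutes)
  show "bij_betw (mirror_swap l k) {..<l} {..<l}"
    using mirror_swap_simps(3,4) by (intro bij_betw_byWitness[of _ "mirror_swap l k"]) auto
  show "mirror_swap l k i = i" if "i \<notin> {..<l}" for i
    using that l unfolding mirror_swap_def by auto
qed

lemma mirror_swap_mirror:
  assumes "i < l"
  shows "mirror_swap l k (l - Suc i) = l - Suc (mirror_swap l k i)"
proof -
  \<comment> \<open>With \<open>l = r + k + 2\<close> the mirrored pair of positions is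
    \<open>r\<close>, \<open>Suc r\<close>, which removes the truncated subtractions.\<close>
  obtain r where r: "l = r + Suc (Suc k)" using l(2) by (metis add.commute less_iff_Suc_add add_Suc_right)
  obtain i' where i': "l = i + Suc i'" using assms by (metis add_Suc_right less_iff_Suc_add)
  have ne: "r \<noteq> Suc k" "k \<noteq> Suc r" using l(1) unfolding r by auto
  have i: "l - Suc i = i'" "l - Suc k = Suc r" "l - Suc (Suc k) = r" using r i' by simp_all
  consider "i = k" "i' = Suc r" | "i = Suc k" "i' = r" | "i = Suc r" "i' = k" | "i = r" "i' = Suc k"
    | "i \<notin> {k, Suc k, r, Suc r}" "i' \<notin> {k, Suc k, r, Suc r}"
    using r i' by force
  then show ?thesis
    using ne i r unfolding mirror_swap_def by cases simp_all
qed

lemma mirror_swap_inversion: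
  assumes "i < j" "j < l" "\<not> mirror_swap l k i < mirror_swap l k j"
  shows "i = k \<and> j = Suc k \<or> i = l - Suc (Suc k) \<and> j = l - Suc k"
proof -
  obtain r where r: "l = r + Suc (Suc k)" using l(2) by (metis add.commute less_iff_Suc_add add_Suc_right)
  have ne: "r \<noteq> Suc k" "k \<noteq> Suc r" using l(1) unfolding r by auto
  have i: "l - Suc k = Suc r" "l - Suc (Suc k) = r" using r by simp_all
  show ?thesis
    using assms(1,3) ne unfolding mirror_swap_def i by (simp split: if_splits)
qed

end

text \<open>The Bender--Knuth involution, performed at the mirrored positions as well so that the
  word stays symmetric. One comparison suffices, since a word of \<open>sym_words V P\<close> never
  has \<open>xs ! Suc k\<close> below \<open>xs ! k\<close>.\<close>

definition toggle :: "(int \<times> int) set \<Rightarrow> nat \<Rightarrow> int list \<Rightarrow> int list" where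
  "toggle P k xs =
     (if (xs ! k, xs ! Suc k) \<in> P then xs else permute_list (mirror_swap (length xs) k) xs)"

lemma lower_adjacent_nth:
  assumes "distinct xs" "j < length xs"
  shows "lower_adjacent P (xs ! j) xs \<longleftrightarrow> j = 0 \<or> (xs ! (j - 1), xs ! j) \<in> P"
  using assms unfolding lower_adjacent_def by (metis nth_eq_iff_index_eq)

lemma length_sym_words: "xs \<in> sym_words V P \<Longrightarrow> length xs = card V"
  by (auto simp: sym_words_def distinct_card)

context
  fixes V :: "int set" and P :: "(int \<times> int) set"
  assumes P: "sym_order P" and V: "finite V" "0 \<notin> V"
begin

lemma toggle_cases:
  assumes xs: "xs \<in> sym_words V P" and k: "Suc k < length xs"
  shows "(xs ! k, xs ! Suc k) \<in> P \<and> toggle P k xs = xs \<or>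
    (xs ! k, xs ! Suc k) \<notin> P \<and> toggle P k xs ! k = xs ! Suc k \<and> toggle P k xs ! Suc k = xs ! k \<and>
    toggle P k (toggle P k xs) = xs"
proof (cases "(xs ! k, xs ! Suc k) \<in> P")
  case False
  let ?f = "mirror_swap (length xs) k"
  have ev: "even (length xs)" using even_length_sym_words[OF xs V(2)] .
  note ms = mirror_swap_simps[OF ev k] and ps = mirror_swap_permutes[OF ev k]
  have nth: "permute_list ?f xs ! i = xs ! ?f i" if "i < length xs" for i
    using that ps by (simp add: permute_list_nth)
  have "(xs ! Suc k, xs ! k) \<notin> P"
    using xs k by (auto simp: sym_words_def sorted_wrt_iff_nth_less)
  moreover have "permute_list ?f (permute_list ?f xs) = xs"
    using ps by (intro nth_equalityI) (simp_all add: permute_list_nth ms)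
  ultimately show ?thesis
    using False k nth ms by (simp add: toggle_def)
qed (simp add: toggle_def)

text \<open>Only the exchanged neighbours and their mirror images change order. The former are
  unrelated in \<open>P\<close>, and by the symmetry of \<open>P\<close> so are the latter.\<close>

lemma toggle_in_sym_words:
  assumes xs: "xs \<in> sym_words V P" and k: "Suc k < length xs"
  shows "toggle P k xs \<in> sym_words V P"
proof (cases "(xs ! k, xs ! Suc k) \<in> P")
  case True
  then show ?thesis using xs by (simp add: toggle_def)
next
  case False
  define l where "l = length xs"
  let ?f = "mirror_swap l k"
  have ev: "even l" using even_length_sym_words[OF xs V(2)] by (simp add: l_def)
  have k: "Suc k < l" using k by (simp add: l_def)
  note ms = mirror_swap_simps[OF ev k] and ps = mirror_swap_permutes[OF ev k]
  define ys where "ys = permute_list ?f xs"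
  have len: "length ys = l" by (simp add: ys_def l_def)
  have nth: "ys ! i = xs ! ?f i" if "i < l" for i
    using that ps by (simp add: permute_list_nth l_def ys_def)
  have f_less: "?f i < l" if "i < l" for i
    using ms(4) that by simp
  have mir: "xs ! (l - Suc i) = - xs ! i" if "i < l" for i
    using sym_words_nth_mirror[OF xs] that by (simp add: l_def)
  have srt: "(xs ! j, xs ! i) \<notin> P" if "i < j" "j < l" for i j
    using xs that by (auto simp: sym_words_def sorted_wrt_iff_nth_less l_def)
  have "(ys ! j, ys ! i) \<notin> P" if ij: "i < j" "j < l" for i j
  proof (cases "?f i < ?f j")
    case True
    then show ?thesis using srt f_less nth ij by simp
  next
    case neg: False
    have "(ys ! j, ys ! i) = (xs ! k, xs ! Suc k) \<or> (ys ! j, ys ! i) = (- xs ! Suc k, - xs ! k)"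
      using mirror_swap_inversion[OF ev k ij neg] 
    proof
      assume "i = k \<and> j = Suc k"
      then show ?thesis using nth k ms by simp
    next
      assume a: "i = l - Suc (Suc k) \<and> j = l - Suc k"
      have "?f i = l - Suc k" "?f j = l - Suc (Suc k)"
        using a mirror_swap_mirror[OF ev k, of "Suc k"] mirror_swap_mirror[OF ev k, of k] ms k by auto
      then show ?thesis using nth ij mir k by simp
    qed
    then show ?thesis
      using False sym_orderD(3)[OF P, of "- xs ! Suc k" "- xs ! k"] by auto
  qed
  then have "sorted_wrt (\<lambda>a b. (b, a) \<notin> P) ys"
    by (simp add: sorted_wrt_iff_nth_less len)
  moreover have "rev ys = map uminus ys"
  proof (rule nth_equalityI)
    fix i assume "i < length (rev ys)"
    then have i: "i < l" by (simp add: len)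
    then show "rev ys ! i = map uminus ys ! i"
      using nth[of "l - Suc i"] nth[of i] mir[OF f_less[OF i]] mirror_swap_mirror[OF ev k i]
      by (simp add: rev_nth len)
  qed simp
  ultimately have "ys \<in> sym_words V P"
    using xs ps by (auto simp: sym_words_def ys_def l_def)
  then show ?thesis using False by (simp add: toggle_def ys_def l_def)
qed

lemma toggle_toggle:
  assumes "xs \<in> sym_words V P" "Suc k < length xs"
  shows "toggle P k (toggle P k xs) = xs"
  using toggle_cases[OF assms] by metis

text \<open>The sum of \<open>g\<close> over the promotion path of a word: a letter is carried from position \<open>k\<close>
  down to position \<open>0\<close> by toggles, and is dropped in favour of its left neighbour when that neighbour
  is smaller in \<open>P\<close>. The letters carried successively form a chain of \<open>P\<close>.\<close>

primrec path_weight :: "(int \<Rightarrow> nat) \<Rightarrow> nat \<Rightarrow> int list \<Rightarrow> nat" where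
  "path_weight g 0 xs = g (xs ! 0)"
| "path_weight g (Suc k) xs =
     (if (xs ! k, xs ! Suc k) \<in> P then g (xs ! Suc k) else 0) + path_weight g k (toggle P k xs)"

text \<open>That \<open>xs ! k\<close> dominates \<open>C\<close> is carried along for the
  induction: a letter above \<open>xs ! k\<close> is then above all of \<open>C\<close> and extends
  the chain, and otherwise the toggle moves that letter to position \<open>k\<close>.\<close>

lemma path_weight_chain:
  assumes "xs \<in> sym_words V P" "k < card V"
  shows "\<exists>C\<subseteq>V. (\<forall>a\<in>C. \<forall>b\<in>C. a = b \<or> (a, b) \<in> P \<or> (b, a) \<in> P) \<and>
    (\<forall>c\<in>C. c = xs ! k \<or> (c, xs ! k) \<in> P) \<and> path_weight g k xs = sum g C"
  using assms
proof (induction k arbitrary: xs)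
  case 0
  then have "xs ! 0 \<in> V"
    using nth_mem[of 0 xs] length_sym_words[OF 0(1)] by (auto simp: sym_words_def)
  then show ?case by (intro exI[of _ "{xs ! 0}"]) auto
next
  case (Suc k)
  have len: "Suc k < length xs" using Suc.prems length_sym_words by simp
  have inV: "xs ! Suc k \<in> V" using len Suc.prems(1) nth_mem by (auto simp: sym_words_def)
  from Suc.IH[OF toggle_in_sym_words[OF Suc.prems(1) len]] Suc.prems(2)
  obtain C where C: "C \<subseteq> V" "\<forall>a\<in>C. \<forall>b\<in>C. a = b \<or> (a, b) \<in> P \<or> (b, a) \<in> P"
    "\<forall>c\<in>C. c = toggle P k xs ! k \<or> (c, toggle P k xs ! k) \<in> P"
    "path_weight g k (toggle P k xs) = sum g C"
    by auto
  show ?case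
  proof (cases "(xs ! k, xs ! Suc k) \<in> P")
    case True
    then have t: "toggle P k xs = xs" by (simp add: toggle_def)
    have below: "(c, xs ! Suc k) \<in> P" if "c \<in> C" for c
      using C(3) that True sym_orderD(2)[OF P, of c "xs ! k" "xs ! Suc k"] unfolding t by auto
    then have "xs ! Suc k \<notin> C" using sym_orderD(1)[OF P] by blast
    moreover have "finite C" using C(1) V(1) by (rule finite_subset)
    ultimately have "path_weight g (Suc k) xs = sum g (insert (xs ! Suc k) C)"
      using True C(4) by simp
    then show ?thesis
      using C(1,2) below inV by (intro exI[of _ "insert (xs ! Suc k) C"]) auto
  next
    case False
    then have "toggle P k xs ! k = xs ! Suc k" using toggle_cases[OF Suc.prems(1) len] by simp
    then show ?thesis using C False by (intro exI[of _ C]) auto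
  qed
qed

text \<open>The toggle permutes \<open>sym_words V P\<close>, so in the total over all words the
  recursive call on the toggled word may be replaced by one on the word itself. What remains counts
  letters at fixed positions, exactly those that are lower adjacent.\<close>

lemma sum_path_weight:
  assumes "k < card V"
  shows "(\<Sum>xs\<in>sym_words V P. path_weight g k xs) =
    (\<Sum>xs\<in>sym_words V P. \<Sum>j\<le>k. if j = 0 \<or> (xs ! (j - 1), xs ! j) \<in> P then g (xs ! j) else 0)"
  using assms
proof (induction k)
  case (Suc k)
  let ?L = "sym_words V P"
  have len: "Suc k < length xs" if "xs \<in> ?L" for xs using Suc.prems length_sym_words[OF that] by simp
  have "bij_betw (toggle P k) ?L ?L"
    using toggle_toggle toggle_in_sym_words len
    by (intro bij_betw_byWitness[of _ "toggle P k"]) auto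
  then have "(\<Sum>xs\<in>?L. path_weight g k (toggle P k xs)) = (\<Sum>xs\<in>?L. path_weight g k xs)"
    by (rule sum.reindex_bij_betw)
  then show ?case
    using Suc by (simp add: sum.distrib)
qed simp

text \<open>By \<open>ex_insertion\<close>, deleting \<open>x\<close> and \<open>- x\<close> maps
  the lower adjacent words onto a set containing all words on the smaller alphabet.\<close>

lemma card_sym_words_delete:
  assumes "x \<in> V" "- x \<in> V"
  shows "card (sym_words (V - {x, - x}) P) \<le> card {xs \<in> sym_words V P. lower_adjacent P x xs}"
proof -
  have "sym_words (V - {x, - x}) P \<subseteq>
      filter (\<lambda>z. z \<notin> {x, - x}) ` {xs \<in> sym_words V P. lower_adjacent P x xs}"
    using ex_insertion[OF P V(2) assms] by (smt (verit) image_iff mem_Collect_eq subsetI)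
  then show ?thesis
    using surj_card_le[of "{xs \<in> sym_words V P. lower_adjacent P x xs}"] finite_sym_words[OF V(1)]
    by simp
qed

lemma sum_card_delete_le:
  assumes sym: "\<And>v. v \<in> V \<Longrightarrow> - v \<in> V"
    and g: "\<And>C. C \<subseteq> V \<Longrightarrow> (\<forall>a\<in>C. \<forall>b\<in>C. a = b \<or> (a, b) \<in> P \<or> (b, a) \<in> P) \<Longrightarrow> sum g C \<le> K"
  shows "(\<Sum>x\<in>V. g x * card (sym_words (V - {x, - x}) P)) \<le> K * card (sym_words V P)"
proof (cases "V = {}")
  case False
  let ?L = "sym_words V P"
  \<comment> \<open>Paths start at the last position, so that every letter of the word is taken into
    account.\<close>
  define k where "k = card V - 1"
  have k: "k < card V" "card V = Suc k" using False V(1) by (auto simp: k_def card_gt_0_iff)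
  have fin: "finite ?L" by (rule finite_sym_words[OF V(1)])
  \<comment> \<open>A word lists each letter of \<open>V\<close> once, so a sum over letters is a
    sum over positions.\<close>
  have inner: "(\<Sum>x\<in>V. if lower_adjacent P x xs then g x else 0) =
    (\<Sum>j\<le>k. if j = 0 \<or> (xs ! (j - 1), xs ! j) \<in> P then g (xs ! j) else 0)" if xs: "xs \<in> ?L" for xs
  proof -
    have d: "distinct xs" "set xs = V" "length xs = Suc k"
      using xs length_sym_words[OF xs] k by (auto simp: sym_words_def)
    have "bij_betw ((!) xs) {..k} V"
      using bij_betw_nth[OF d(1) refl refl] d by (simp add: lessThan_Suc_atMost)
    then have "(\<Sum>x\<in>V. if lower_adjacent P x xs then g x else 0) =
      (\<Sum>j\<le>k. if lower_adjacent P (xs ! j) xs then g (xs ! j) else 0)"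
      by (rule sum.reindex_bij_betw[symmetric])
    also have "\<dots> = (\<Sum>j\<le>k. if j = 0 \<or> (xs ! (j - 1), xs ! j) \<in> P then g (xs ! j) else 0)"
    proof (rule sum.cong[OF refl])
      fix j assume "j \<in> {..k}"
      then have "lower_adjacent P (xs ! j) xs \<longleftrightarrow> j = 0 \<or> (xs ! (j - 1), xs ! j) \<in> P"
        using lower_adjacent_nth d by (simp add: less_Suc_eq_le)
      then show "(if lower_adjacent P (xs ! j) xs then g (xs ! j) else 0) =
        (if j = 0 \<or> (xs ! (j - 1), xs ! j) \<in> P then g (xs ! j) else 0)" by simp
    qed
    finally show ?thesis .
  qed
  have "(\<Sum>x\<in>V. g x * card (sym_words (V - {x, - x}) P)) \<le>
      (\<Sum>x\<in>V. g x * card {xs \<in> ?L. lower_adjacent P x xs})"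
    using card_sym_words_delete sym by (intro sum_mono mult_le_mono2) auto
  also have "\<dots> = (\<Sum>x\<in>V. \<Sum>xs\<in>?L. if lower_adjacent P x xs then g x else 0)"
    using fin by (intro sum.cong) (auto simp: sum.If_cases Int_def)
  also have "\<dots> = (\<Sum>xs\<in>?L. path_weight g k xs)"
    unfolding sum_path_weight[OF k(1)] by (subst sum.swap) (simp add: inner)
  also have "\<dots> \<le> (\<Sum>xs\<in>?L. K)"
  proof (rule sum_mono)
    fix xs assume "xs \<in> ?L"
    from path_weight_chain[OF this k(1), of g] show "path_weight g k xs \<le> K"
      using g by force
  qed
  finally show ?thesis by (simp add: mult.commute)
qed simp

end

section \<open>The product inequality for two compatible symmetric orders\<close>

text \<open>The last letter \<open>x\<close> of a symmetric extension is maximal in \<open>R\<close>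
  and the first is \<open>- x\<close>. Stripping both leaves an extension of the restricted order,
  and together with \<open>x\<close> it determines the word.\<close>

lemma card_sym_words_le_sum:
  assumes V: "finite V" "V \<noteq> {}" "0 \<notin> V" and R: "sym_order R"
  shows "card (sym_words V R) \<le>
    (\<Sum>x\<in>{x \<in> V. \<forall>y\<in>V. (x, y) \<notin> R}. card (sym_words (V - {x, - x}) R))"
proof -
  let ?M = "{x \<in> V. \<forall>y\<in>V. (x, y) \<notin> R}"
  let ?f = "\<lambda>xs. (last xs, butlast (tl xs))"
  have dec: "xs = - last xs # butlast (tl xs) @ [last xs]" if xs: "xs \<in> sym_words V R" for xs
  proof -
    have ne: "xs \<noteq> []" using xs V(2) by (auto simp: sym_words_def)
    have ev: "even (length xs)" using even_length_sym_words[OF xs V(3)] .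
    have "tl xs \<noteq> []" using ev ne by (cases xs) auto
    moreover have "hd xs = - last xs"
      using sym_words_nth_mirror[OF xs, of "length xs - 1"] ne by (simp add: hd_conv_nth last_conv_nth)
    ultimately show ?thesis using ne by (metis append_butlast_last_id last_tl list.collapse)
  qed
  have inj: "inj_on ?f (sym_words V R)"
    by (rule inj_onI) (metis dec prod.inject)
  have sub: "?f ` sym_words V R \<subseteq> Sigma ?M (\<lambda>x. sym_words (V - {x, - x}) R)"
  proof (rule image_subsetI)
    fix xs assume xs: "xs \<in> sym_words V R"
    define x ys where "x = last xs" and "ys = butlast (tl xs)"
    have eq: "xs = - x # ys @ [x]" using dec[OF xs] by (simp add: x_def ys_def)
    have *: "distinct (- x # ys @ [x])" "insert (- x) (insert x (set ys)) = V" "rev ys = map uminus ys"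
      "sorted_wrt (\<lambda>a b. (b, a) \<notin> R) (- x # ys @ [x])"
      using xs unfolding sym_words_def eq by auto
    have "ys \<in> sym_words (V - {x, - x}) R"
      using * unfolding sym_words_def by (auto simp: sorted_wrt_append)
    moreover have "x \<in> ?M"
      using * sym_orderD(1)[OF R] by (auto simp: sorted_wrt_append)
    ultimately show "(last xs, butlast (tl xs)) \<in> Sigma ?M (\<lambda>x. sym_words (V - {x, - x}) R)"
      by (simp flip: x_def ys_def)
  qed
  have "card (sym_words V R) \<le> card (Sigma ?M (\<lambda>x. sym_words (V - {x, - x}) R))"
    using V(1) finite_sym_words by (intro card_inj_on_le[OF inj sub]) auto
  also have "\<dots> = (\<Sum>x\<in>?M. card (sym_words (V - {x, - x}) R))"
    using V(1) finite_sym_words by (intro card_SigmaI) auto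
  finally show ?thesis .
qed

text \<open>\<open>PQ\<close> expresses compatibility: letters comparable in both orders are ordered
  the same way, hence comparable in \<open>P \<inter> Q\<close>. The induction removes a letter and
  its negative.\<close>

lemma card_sym_words_Int_le:
  assumes P: "sym_order P" and Q: "sym_order Q" and PQ: "\<And>a b. (a, b) \<in> P \<Longrightarrow> (b, a) \<notin> Q"
  shows "finite V \<Longrightarrow> 0 \<notin> V \<Longrightarrow> (\<And>v. v \<in> V \<Longrightarrow> - v \<in> V) \<Longrightarrow>
    card (sym_words V (P \<inter> Q)) \<le> card (sym_words V P) * card (sym_words V Q)"
proof (induction "card V" arbitrary: V rule: less_induct)
  case less
  show ?case
  proof (cases "V = {}")
    case True
    have "sym_words {} S = {[]}" for S by (auto simp: sym_words_def)
    then show ?thesis using True by simp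
  next
    case False
    let ?e = "\<lambda>x S. card (sym_words (V - {x, - x}) S)"
    let ?M = "{x \<in> V. \<forall>y\<in>V. (x, y) \<notin> P \<inter> Q}"
    have IH: "?e x (P \<inter> Q) \<le> ?e x P * ?e x Q" if "x \<in> ?M" for x
    proof (rule less.hyps)
      show "card (V - {x, - x}) < card V"
        using less.prems(1) that by (intro psubset_card_mono) auto
      show "- v \<in> V - {x, - x}" if "v \<in> V - {x, - x}" for v
        using less.prems(3)[of v] that minus_minus[of v] by auto
    qed (use less.prems in auto)
    \<comment> \<open>The weight for the inequality of \<open>P\<close>; its bound on
      \<open>P\<close>-chains comes from the inequality of \<open>Q\<close>.\<close>
    define g where "g x = (if x \<in> ?M then ?e x Q else 0)" for x
    have gC: "sum g C \<le> card (sym_words V Q)"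
      if C: "C \<subseteq> V" "\<forall>a\<in>C. \<forall>b\<in>C. a = b \<or> (a, b) \<in> P \<or> (b, a) \<in> P" for C
    proof -
      \<comment> \<open>The indicator of \<open>C \<inter> ?M\<close>, a \<open>Q\<close>-antichain,
        so every \<open>Q\<close>-chain has weight at most 1.\<close>
      define h :: "int \<Rightarrow> nat" where "h x = (if x \<in> C \<inter> ?M then 1 else 0)" for x
      have fin: "finite C" using C(1) less.prems(1) by (rule finite_subset)
      have "(\<Sum>x\<in>V. h x * ?e x Q) \<le> 1 * card (sym_words V Q)"
      proof (rule sum_card_delete_le[OF Q less.prems])
        fix D assume D: "D \<subseteq> V" "\<forall>a\<in>D. \<forall>b\<in>D. a = b \<or> (a, b) \<in> Q \<or> (b, a) \<in> Q"
        have "a = b" if "a \<in> D \<inter> (C \<inter> ?M)" "b \<in> D \<inter> (C \<inter> ?M)" for a b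
        proof -
          have "a = b \<or> (a, b) \<in> P \<or> (b, a) \<in> P" "a = b \<or> (a, b) \<in> Q \<or> (b, a) \<in> Q"
            "(a, b) \<notin> P \<inter> Q" "(b, a) \<notin> P \<inter> Q"
            using that C(2) D(2) by auto
          then show ?thesis using PQ by auto
        qed
        then have "card (D \<inter> (C \<inter> ?M)) \<le> 1"
          using fin by (simp add: card_le_Suc0_iff_eq)
        moreover have "sum h D = card (D \<inter> (C \<inter> ?M))"
          using finite_subset[OF D(1) less.prems(1)] unfolding h_def
          by (simp add: sum.If_cases Int_def)
        ultimately show "sum h D \<le> 1" by simp
      qed
      moreover have "sum g C = (\<Sum>x\<in>V. h x * ?e x Q)"
        using C(1) less.prems(1)
        by (intro sum.mono_neutral_cong_left) (auto simp: g_def h_def)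
      ultimately show ?thesis by simp
    qed
    have "card (sym_words V (P \<inter> Q)) \<le> (\<Sum>x\<in>?M. ?e x (P \<inter> Q))"
      using card_sym_words_le_sum[OF _ _ _ sym_order_Int[OF P Q]] False less.prems by blast
    also have "\<dots> \<le> (\<Sum>x\<in>?M. ?e x P * ?e x Q)" by (rule sum_mono) (rule IH)
    also have "\<dots> = (\<Sum>x\<in>V. g x * ?e x P)"
      using less.prems(1) by (intro sum.mono_neutral_cong_left) (auto simp: g_def)
    also have "\<dots> \<le> card (sym_words V Q) * card (sym_words V P)"
      by (rule sum_card_delete_le[OF P less.prems gC])
    finally show ?thesis by (simp add: mult.commute)
  qed
qed

section \<open>Isometric embeddings into hypercubes\<close>

text \<open>Since \<open>card (S u - S v)\<close> obeys the triangle inequality and vanishes only for \<open>u = v\<close>, it is the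
  graph distance. The differences are one-sided because in the applications
  all sets \<open>S v\<close> are equinumerous.\<close>

locale hypercube_embedding = wf_digraph G for G :: "('a, 'b) pre_digraph" +
  fixes S :: "'a \<Rightarrow> 'h set"
  assumes finite_verts: "finite (verts G)"
    and finite_S: "v \<in> verts G \<Longrightarrow> finite (S v)"
    and card_arc: "e \<in> arcs G \<Longrightarrow> card (S (tail G e) - S (head G e)) \<le> 1"
    and closer: "u \<in> verts G \<Longrightarrow> v \<in> verts G \<Longrightarrow> u \<noteq> v \<Longrightarrow>
      \<exists>e\<in>arcs G. tail G e = u \<and> card (S (head G e) - S v) < card (S u - S v)"
begin

lemma awalk_cost_one: "awalk_cost (\<lambda>_. 1) p = real (length p)"
  by (induction p) auto

lemma card_Diff_le_length:
  assumes "awalk u p v"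
  shows "card (S u - S v) \<le> length p"
  using assms
proof (induction p arbitrary: u)
  case Nil
  then show ?case by (simp add: awalk_Nil_iff)
next
  case (Cons e p)
  then have e: "e \<in> arcs G" "u = tail G e" "awalk (head G e) p v"
    by (simp_all add: awalk_Cons_iff)
  have fin: "finite (S u)" "finite (S (head G e))" using finite_S e by auto
  have "card (S u - S v) \<le> card ((S u - S (head G e)) \<union> (S (head G e) - S v))"
    using fin by (intro card_mono) auto
  also have "\<dots> \<le> card (S u - S (head G e)) + card (S (head G e) - S v)" by (rule card_Un_le)
  also have "\<dots> \<le> 1 + length p" using card_arc[OF e(1)] e(2) Cons.IH[OF e(3)] by simp
  finally show ?case by simp
qed

lemma ex_short_awalk:
  assumes "u \<in> verts G" "v \<in> verts G"
  shows "\<exists>p. awalk u p v \<and> length p \<le> card (S u - S v)"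
  using assms(1)
proof (induction "card (S u - S v)" arbitrary: u rule: less_induct)
  case less
  show ?case
  proof (cases "u = v")
    case True
    then show ?thesis using less.prems by (intro exI[of _ "[]"]) (simp add: awalk_Nil_iff)
  next
    case False
    then obtain e where e: "e \<in> arcs G" "tail G e = u" "card (S (head G e) - S v) < card (S u - S v)"
      using closer[OF less.prems assms(2)] by blast
    then obtain p where "awalk (head G e) p v" "length p \<le> card (S (head G e) - S v)"
      using less.hyps[OF e(3)] by auto
    then show ?thesis using e by (intro exI[of _ "e # p"]) (simp add: awalk_Cons_iff)
  qed
qed

lemma graph_dist_eq:
  assumes "u \<in> verts G" "v \<in> verts G"
  shows "graph_dist G u v = ereal (real (card (S u - S v)))"
proof (rule antisym)
  obtain p where p: "awalk u p v" "length p \<le> card (S u - S v)"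
    using ex_short_awalk[OF assms] by blast
  then show "graph_dist G u v \<le> ereal (real (card (S u - S v)))"
    unfolding graph_dist_def \<mu>_def awalk_cost_one by (intro INF_lower2[of p]) auto
  show "ereal (real (card (S u - S v))) \<le> graph_dist G u v"
    unfolding graph_dist_def \<mu>_def awalk_cost_one
    by (rule INF_greatest) (simp add: card_Diff_le_length)
qed

lemma graph_dist_add_eq_iff:
  assumes "u \<in> verts G" "v \<in> verts G" "w \<in> verts G"
  shows "graph_dist G u w + graph_dist G w v = graph_dist G u v \<longleftrightarrow>
    card (S u - S w) + card (S w - S v) = card (S u - S v)"
  using assms by (simp add: graph_dist_eq flip: of_nat_add)

text \<open>Such a \<open>z\<close> lies on a shortest path from \<open>u\<close> to
  \<open>v\<close>: the two inclusions make \<open>S u - S v\<close> the disjoint union of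
  \<open>S u - S z\<close> and \<open>S z - S v\<close>.\<close>

lemma between_in_graph_conv:
  assumes "u \<in> verts G" "v \<in> verts G"
  shows "{z \<in> verts G. S u \<inter> S v \<subseteq> S z \<and> S z \<subseteq> S u \<union> S v} \<subseteq> graph_conv G {u, v}"
proof clarify
  fix z assume z: "z \<in> verts G" "S u \<inter> S v \<subseteq> S z" "S z \<subseteq> S u \<union> S v"
  have "S u - S v = (S u - S z) \<union> (S z - S v)" "(S u - S z) \<inter> (S z - S v) = {}"
    using z by auto
  then have "card (S u - S z) + card (S z - S v) = card (S u - S v)"
    using finite_S z(1) assms by (simp add: card_Un_disjoint)
  then have "graph_dist G u z + graph_dist G z v = graph_dist G u v"
    using graph_dist_add_eq_iff z(1) assms by blast
  then show "z \<in> graph_conv G {u, v}"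
    using z(1) unfolding graph_conv_def graph_convex_def by blast
qed

text \<open>A detour through some \<open>w\<close> with \<open>h \<notin> S w\<close> loses
  \<open>h\<close> on the way from \<open>u\<close> and regains it towards \<open>v\<close>. As
  \<open>h\<close> does not count in \<open>S u - S v\<close>, the detour is strictly
  longer.\<close>

lemma graph_convex_halfspace: "graph_convex G {z \<in> verts G. h \<in> S z}"
  unfolding graph_convex_def
proof (intro conjI ballI impI)
  fix u v w
  assume uv: "u \<in> {z \<in> verts G. h \<in> S z}" "v \<in> {z \<in> verts G. h \<in> S z}" and w: "w \<in> verts G"
    and d: "graph_dist G u w + graph_dist G w v = graph_dist G u v"
  show "w \<in> {z \<in> verts G. h \<in> S z}"
  proof (rule ccontr)
    assume "w \<notin> {z \<in> verts G. h \<in> S z}"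
    then have h: "h \<in> S u - S w" "h \<notin> S u - S v" using uv w by auto
    have fin: "finite (S u)" "finite (S w)" using uv w finite_S by auto
    have "card (S u - S v) \<le> card ((S u - S w - {h}) \<union> (S w - S v))"
      using fin h(2) by (intro card_mono) auto
    also have "\<dots> \<le> card (S u - S w - {h}) + card (S w - S v)" by (rule card_Un_le)
    also have "\<dots> < card (S u - S w) + card (S w - S v)"
      using fin h(1) by (intro add_strict_right_mono card_Diff1_less) auto
    finally show False using d graph_dist_add_eq_iff uv w by auto
  qed
qed auto

lemma graph_conv_subset:
  assumes "X \<subseteq> verts G"
  shows "graph_conv G X \<subseteq> {z \<in> verts G. (\<Inter>x\<in>X. S x) \<subseteq> S z}"
proof (intro subsetI CollectI conjI)
  fix z assume z: "z \<in> graph_conv G X"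
  have "graph_convex G (verts G)" by (simp add: graph_convex_def)
  then show "z \<in> verts G" using z assms by (auto simp: graph_conv_def)
  fix h assume h: "h \<in> (\<Inter>x\<in>X. S x)"
  show "h \<in> S z"
    using z h assms graph_convex_halfspace[of h] unfolding graph_conv_def by auto
qed

text \<open>The hull of three vertices is bounded from above by halfspaces, the hulls of two
  vertices from below by intervals.\<close>

lemma strong_hull_propertyI:
  assumes "\<And>u v w. u \<in> verts G \<Longrightarrow> v \<in> verts G \<Longrightarrow> w \<in> verts G \<Longrightarrow>
    card {z \<in> verts G. S u \<inter> S v \<inter> S w \<subseteq> S z} \<le>
    card {z \<in> verts G. S u \<inter> S v \<subseteq> S z \<and> S z \<subseteq> S u \<union> S v} *
    card {z \<in> verts G. S v \<inter> S w \<subseteq> S z \<and> S z \<subseteq> S v \<union> S w}"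
  shows "strong_hull_property G"
  unfolding strong_hull_property_def
proof (intro ballI)
  fix u v w assume V: "u \<in> verts G" "v \<in> verts G" "w \<in> verts G"
  have fin: "finite (graph_conv G X)" if "X \<subseteq> verts G" for X
    using graph_conv_subset[OF that] finite_verts by (auto intro: finite_subset)
  have "card (graph_conv G {u, v, w}) \<le> card {z \<in> verts G. S u \<inter> S v \<inter> S w \<subseteq> S z}"
    using graph_conv_subset[of "{u, v, w}"] V finite_verts
    by (intro card_mono) (auto simp: Int_assoc)
  also note assms[OF V]
  also have "card {z \<in> verts G. S u \<inter> S v \<subseteq> S z \<and> S z \<subseteq> S u \<union> S v} *
    card {z \<in> verts G. S v \<inter> S w \<subseteq> S z \<and> S z \<subseteq> S v \<union> S w} \<le>
    card (graph_conv G {u, v}) * card (graph_conv G {v, w})"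
    using V by (intro mult_le_mono card_mono fin between_in_graph_conv) auto
  finally show "card (graph_conv G {u, v, w}) \<le> card (graph_conv G {u, v}) * card (graph_conv G {v, w})" .
qed

end

section \<open>The hyperoctahedral group\<close>

definition signed_range :: "nat \<Rightarrow> int set" where
  "signed_range n = {- int n..int n} - {0}"

lemma signed_range:
  "finite (signed_range n)" "0 \<notin> signed_range n" "- i \<in> signed_range n \<longleftrightarrow> i \<in> signed_range n"
  by (auto simp: signed_range_def)

lemma carrier_hyperoctahedral:
  "x \<in> carrier (hyperoctahedral_group n) \<longleftrightarrow>
    x permutes signed_range n \<and> (\<forall>i\<in>signed_range n. x (- i) = - x i)"
  by (simp add: hyperoctahedral_group_def signed_range_def)

lemma hyperoctahedralD:
  assumes "x \<in> carrier (hyperoctahedral_group n)"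
  shows "x permutes signed_range n" "x (- i) = - x i"
proof -
  show p: "x permutes signed_range n" using assms by (simp add: carrier_hyperoctahedral)
  show "x (- i) = - x i"
    using assms permutes_not_in[OF p] signed_range(3)[of i n]
    by (cases "i \<in> signed_range n") (simp_all add: carrier_hyperoctahedral)
qed

lemma finite_hyperoctahedral: "finite (carrier (hyperoctahedral_group n))"
  using hyperoctahedralD(1)
  by (intro finite_subset[OF _ finite_permutations[OF signed_range(1)[of n]]]) auto

lemma mult_hyperoctahedral [simp]: "x \<otimes>\<^bsub>hyperoctahedral_group n\<^esub> y = x \<circ> y"
  by (simp add: hyperoctahedral_group_def)

text \<open>The letter \<open>a\<close> precedes the letter \<open>b\<close> in the window notation of \<open>x\<close>; right
  multiplication acts on positions.\<close>

definition word_order :: "nat \<Rightarrow> (int \<Rightarrow> int) \<Rightarrow> (int \<times> int) set" where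
  "word_order n x = {(x p, x q) | p q. p \<in> signed_range n \<and> q \<in> signed_range n \<and> p < q}"

context
  fixes n :: nat and x :: "int \<Rightarrow> int"
  assumes x: "x \<in> carrier (hyperoctahedral_group n)"
begin

lemma word_order_iff:
  "(x p, x q) \<in> word_order n x \<longleftrightarrow> p \<in> signed_range n \<and> q \<in> signed_range n \<and> p < q"
  using permutes_inj[OF hyperoctahedralD(1)[OF x]] unfolding word_order_def by (auto dest: injD)

lemma signed_range_letter:
  assumes "a \<in> signed_range n"
  obtains p where "p \<in> signed_range n" "a = x p"
  using assms permutes_image[OF hyperoctahedralD(1)[OF x]] by blast

lemma word_order_subset: "word_order n x \<subseteq> signed_range n \<times> signed_range n"
  using permutes_in_image[OF hyperoctahedralD(1)[OF x]] unfolding word_order_def by blast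

lemma word_order_total:
  assumes "a \<in> signed_range n" "b \<in> signed_range n" "a \<noteq> b"
  shows "(a, b) \<in> word_order n x \<longleftrightarrow> (b, a) \<notin> word_order n x"
proof -
  obtain p where p: "p \<in> signed_range n" "a = x p" using assms(1) by (rule signed_range_letter)
  obtain q where q: "q \<in> signed_range n" "b = x q" using assms(2) by (rule signed_range_letter)
  have "p \<noteq> q" using p q assms(3) by auto
  then show ?thesis using p q word_order_iff by auto
qed

lemma word_order_asym: "(a, b) \<in> word_order n x \<Longrightarrow> (b, a) \<notin> word_order n x"
proof -
  assume "(a, b) \<in> word_order n x"
  then obtain p q where "a = x p" "b = x q" "p < q" unfolding word_order_def by blast
  then show ?thesis using word_order_iff by simp
qed

lemma word_order_minus: "(a, b) \<in> word_order n x \<Longrightarrow> (- b, - a) \<in> word_order n x"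
proof -
  assume "(a, b) \<in> word_order n x"
  then obtain p q where "a = x p" "b = x q" "p \<in> signed_range n" "q \<in> signed_range n" "p < q"
    unfolding word_order_def by blast
  then show ?thesis
    using word_order_iff[of "- q" "- p"] hyperoctahedralD(2)[OF x] signed_range(3) by auto
qed

lemma sym_order_word_order: "sym_order (word_order n x)"
  unfolding sym_order_def
proof (intro conjI)
  show "irrefl (word_order n x)" using word_order_asym by (auto simp: irrefl_def)
  show "trans (word_order n x)"
  proof (rule transI)
    fix a b c assume "(a, b) \<in> word_order n x" "(b, c) \<in> word_order n x"
    then obtain p q r where "a = x p" "b = x q" "(x q, c) \<in> word_order n x" "c = x r"
      unfolding word_order_def by blast
    with \<open>(a, b) \<in> _\<close> show "(a, c) \<in> word_order n x" using word_order_iff by auto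
  qed
qed (use word_order_minus in blast)

end

section \<open>Signed permutations as symmetric words\<close>

definition positions :: "nat \<Rightarrow> int list" where
  "positions n = map uminus (rev [1..int n]) @ [1..int n]"

lemma positions:
  "set (positions n) = signed_range n" "sorted_wrt (<) (positions n)" "distinct (positions n)"
  "rev (positions n) = map uminus (positions n)"
proof -
  show s: "sorted_wrt (<) (positions n)"
    by (auto simp: positions_def sorted_wrt_append sorted_wrt_map sorted_wrt_rev sorted_wrt_upto)
  then show "distinct (positions n)" by (simp add: strict_sorted_iff)
  have "uminus ` {1..int n} = {- int n..-1}" by simp
  then show "set (positions n) = signed_range n" by (auto simp: positions_def signed_range_def)
  show "rev (positions n) = map uminus (positions n)"
    by (simp add: positions_def rev_map o_def)
qed

text \<open>Reading a signed permutation along increasing positions yields its word, and the word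
  has no inversion of \<open>P\<close> exactly when every pair of \<open>P\<close> occurs in this
  order.\<close>

lemma bij_betw_sym_words:
  assumes P: "P \<subseteq> signed_range n \<times> signed_range n" "irrefl P"
  shows "bij_betw (\<lambda>z. map z (positions n))
    {z \<in> carrier (hyperoctahedral_group n). P \<subseteq> word_order n z} (sym_words (signed_range n) P)"
    (is "bij_betw ?w ?B ?L")
proof -
  let ?ps = "positions n" and ?V = "signed_range n"
  have valid: "sorted_wrt (\<lambda>a b. (b, a) \<notin> P) (map z ?ps) \<longleftrightarrow> P \<subseteq> word_order n z"
    if z: "z \<in> carrier (hyperoctahedral_group n)" for z
  proof
    assume srt: "sorted_wrt (\<lambda>a b. (b, a) \<notin> P) (map z ?ps)"
    show "P \<subseteq> word_order n z"
    proof (rule subrelI)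
      fix a b assume ab: "(a, b) \<in> P"
      then have V: "a \<in> ?V" "b \<in> ?V" using P(1) by blast+
      have "a \<noteq> b" using ab P(2) by (auto simp: irrefl_def)
      obtain p where "p \<in> ?V" "a = z p" using V(1) by (rule signed_range_letter[OF z])
      moreover obtain q where "q \<in> ?V" "b = z q" using V(2) by (rule signed_range_letter[OF z])
      ultimately have pq: "p \<in> ?V" "q \<in> ?V" "a = z p" "b = z q" "p \<noteq> q" using \<open>a \<noteq> b\<close> by auto
      have "p \<in> set ?ps" "q \<in> set ?ps" using pq(1,2) by (simp_all add: positions(1))
      then obtain i j where ij: "p = ?ps ! i" "q = ?ps ! j" "i < length ?ps" "j < length ?ps"
        unfolding in_set_conv_nth by blast
      have "\<not> j < i"
      proof
        assume "j < i"
        then have "(map z ?ps ! i, map z ?ps ! j) \<notin> P"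
          using sorted_wrt_nth_less[OF srt] ij(3) by simp
        then show False using ab unfolding pq(3,4) ij(1,2) using ij(3,4) by simp
      qed
      moreover have "i \<noteq> j" using pq(5) ij(1,2) by blast
      ultimately have "p < q" using sorted_wrt_nth_less[OF positions(2), of i j n] ij by simp
      then show "(a, b) \<in> word_order n z" using word_order_iff[OF z] pq by simp
    qed
  next
    assume sub: "P \<subseteq> word_order n z"
    show "sorted_wrt (\<lambda>a b. (b, a) \<notin> P) (map z ?ps)"
      unfolding sorted_wrt_map
      by (rule sorted_wrt_mono_rel[OF _ positions(2)]) (use sub word_order_iff[OF z] in force)
  qed
  have into: "?w z \<in> ?L" if "z \<in> ?B" for z
  proof -
    have z: "z \<in> carrier (hyperoctahedral_group n)" using that by simp
    note zD = hyperoctahedralD[OF z]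
    have "rev (map z ?ps) = map uminus (map z ?ps)"
      by (simp add: rev_map positions(4) zD(2))
    moreover have "set (map z ?ps) = ?V" using permutes_image[OF zD(1)] positions(1) by simp
    moreover have "distinct (map z ?ps)"
      using positions(3) permutes_inj_on[OF zD(1)] by (simp add: distinct_map)
    ultimately show ?thesis using that valid[OF z] by (simp add: sym_words_def)
  qed
  have inj: "inj_on ?w ?B"
  proof (rule inj_onI)
    fix z z' assume B: "z \<in> ?B" "z' \<in> ?B" and eq: "?w z = ?w z'"
    then have p: "z permutes ?V" "z' permutes ?V" using hyperoctahedralD(1) by auto
    have "\<forall>i\<in>?V. z i = z' i" using eq positions(1)[of n] by simp
    then show "z = z'" using p by (metis ext permutes_not_in)
  qed
  have "\<exists>z\<in>?B. ?w z = xs" if xs: "xs \<in> ?L" for xs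
  proof -
    \<comment> \<open>The inverse looks the letters up in the word; outside the range it is the
      identity, as the group requires.\<close>
    define z where "z p = (if p \<in> ?V then the (map_of (zip ?ps xs) p) else p)" for p
    have len: "length xs = length ?ps"
      using length_sym_words[OF xs] positions(1,3) distinct_card by metis
    have z_nth: "z (?ps ! i) = xs ! i" if "i < length ?ps" for i
      using that len nth_mem[OF that] positions(1,3) map_of_zip_nth[of ?ps xs i]
      by (simp add: z_def)
    have w: "map z ?ps = xs" using z_nth len by (intro nth_equalityI) auto
    have "z ` ?V = ?V"
      using arg_cong[OF w, of set] positions(1) xs by (simp add: sym_words_def)
    then have "bij_betw z ?V ?V"
      by (simp add: bij_betw_def eq_card_imp_inj_on signed_range(1))
    then have perm: "z permutes ?V" by (rule bij_imp_permutes) (simp add: z_def)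
    have "z (- p) = - z p" if p: "p \<in> ?V" for p
    proof -
      have "p \<in> set ?ps" using p by (simp add: positions(1))
      then obtain i where i: "p = ?ps ! i" "i < length ?ps"
        unfolding in_set_conv_nth by blast
      \<comment> \<open>The list of positions is itself a symmetric word for the empty order, so the
        mirror lemma locates \<open>- p\<close>.\<close>
      have "?ps \<in> sym_words ?V {}" using positions by (simp add: sym_words_def sorted_wrt_true)
      from sym_words_nth_mirror[OF this i(2)] have "- p = ?ps ! (length ?ps - Suc i)" using i(1) by simp
      then have "z (- p) = xs ! (length xs - Suc i)"
        using z_nth[of "length ?ps - Suc i"] i(2) len by simp
      also have "\<dots> = - z p"
        using sym_words_nth_mirror[OF xs, of i] z_nth[of i] i len by simp
      finally show ?thesis .
    qed
    then have "z \<in> carrier (hyperoctahedral_group n)" using perm by (simp add: carrier_hyperoctahedral)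
    moreover have "sorted_wrt (\<lambda>a b. (b, a) \<notin> P) (map z ?ps)" using xs w by (simp add: sym_words_def)
    ultimately show ?thesis using valid w by blast
  qed
  then show ?thesis using inj into unfolding bij_betw_def by blast
qed

text \<open>Both intersections lie in the total order of the middle element \<open>v\<close>, which
  makes them compatible.\<close>

lemma card_word_order_Int_le:
  assumes "u \<in> carrier (hyperoctahedral_group n)" "v \<in> carrier (hyperoctahedral_group n)"
    "w \<in> carrier (hyperoctahedral_group n)"
  shows "card {z \<in> carrier (hyperoctahedral_group n).
      word_order n u \<inter> word_order n v \<inter> word_order n w \<subseteq> word_order n z} \<le>
    card {z \<in> carrier (hyperoctahedral_group n). word_order n u \<inter> word_order n v \<subseteq> word_order n z} *
    card {z \<in> carrier (hyperoctahedral_group n). word_order n v \<inter> word_order n w \<subseteq> word_order n z}"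
proof -
  let ?P = "word_order n u \<inter> word_order n v" and ?Q = "word_order n v \<inter> word_order n w"
  have PQ: "?P \<inter> ?Q = word_order n u \<inter> word_order n v \<inter> word_order n w" by blast
  have so: "sym_order ?P" "sym_order ?Q"
    using assms sym_order_word_order sym_order_Int by blast+
  have card: "card {z \<in> carrier (hyperoctahedral_group n). R \<subseteq> word_order n z} =
      card (sym_words (signed_range n) R)"
    if "sym_order R" "R \<subseteq> word_order n v" for R
    using bij_betw_same_card[OF bij_betw_sym_words[of R n]] that word_order_subset[OF assms(2)]
    by (auto simp: sym_order_def)
  have "card (sym_words (signed_range n) (?P \<inter> ?Q)) \<le>
    card (sym_words (signed_range n) ?P) * card (sym_words (signed_range n) ?Q)"
    using word_order_asym[OF assms(2)] signed_range by (intro card_sym_words_Int_le so) auto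
  moreover have "?P \<inter> ?Q \<subseteq> word_order n v" "?P \<subseteq> word_order n v" "?Q \<subseteq> word_order n v" by blast+
  ultimately show ?thesis
    using card[of "?P \<inter> ?Q"] card[of ?P] card[of ?Q] so sym_order_Int[OF so] unfolding PQ by simp
qed

text \<open>The pairs \<open>(a, b)\<close> and \<open>(- b, - a)\<close> belong to the same reflection; the condition on
  \<open>a + b\<close> selects one of them.\<close>

definition half_order :: "nat \<Rightarrow> (int \<Rightarrow> int) \<Rightarrow> (int \<times> int) set" where
  "half_order n x = {(a, b) \<in> word_order n x. 0 \<le> a + b}"

lemma finite_half_order:
  assumes "x \<in> carrier (hyperoctahedral_group n)"
  shows "finite (half_order n x)"
proof (rule finite_subset)
  show "half_order n x \<subseteq> signed_range n \<times> signed_range n"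
    using word_order_subset[OF assms] unfolding half_order_def by blast
qed (simp add: signed_range(1))

section \<open>Generators and their effect on the order of letters\<close>

text \<open>A common description of both kinds of generators: an involution inverting one pair of
  positions and its mirror image. For the sign change, \<open>p = - 1\<close> and
  \<open>q = 1\<close>, and the two pairs coincide.\<close>

definition flips :: "nat \<Rightarrow> (int \<Rightarrow> int) \<Rightarrow> int \<Rightarrow> int \<Rightarrow> bool" where
  "flips n s p q \<longleftrightarrow> s \<in> carrier (hyperoctahedral_group n) \<and> s \<circ> s = id \<and>
     p \<in> signed_range n \<and> q \<in> signed_range n \<and> p < q \<and> s p = q \<and>
     (\<forall>i\<in>signed_range n. \<forall>j\<in>signed_range n.
        i < j \<longrightarrow> s i < s j \<or> (i, j) = (p, q) \<or> (i, j) = (- q, - p))"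

lemma flips_adjacent:
  assumes "1 \<le> i" "i < int n"
  shows "flips n (transpose i (i + 1) \<circ> transpose (- i) (- (i + 1))) i (i + 1)"
proof -
  have "transpose i (i + 1) \<circ> transpose (- i) (- (i + 1)) \<in> carrier (hyperoctahedral_group n)"
    using assms hyperoctahedral_group_gens_subset[of n] by (auto simp: hyperoctahedral_group_gens_def)
  moreover have "(transpose i (i + 1) \<circ> transpose (- i) (- (i + 1))) \<circ>
      (transpose i (i + 1) \<circ> transpose (- i) (- (i + 1))) = id"
    using assms by (auto simp: fun_eq_iff transpose_def)
  ultimately show ?thesis
    using assms unfolding flips_def by (auto simp: signed_range_def transpose_def)
qed

lemma flips_sign:
  assumes "0 < n"
  shows "flips n (transpose 1 (- 1)) (- 1) 1"
proof -
  have "transpose 1 (- 1) \<in> carrier (hyperoctahedral_group n)"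
    using assms hyperoctahedral_group_gens_subset[of n] by (auto simp: hyperoctahedral_group_gens_def)
  then show ?thesis
    using assms unfolding flips_def by (auto simp: signed_range_def transpose_def)
qed

lemma hyperoctahedral_gens_flips:
  assumes "s \<in> hyperoctahedral_group_gens n"
  obtains p q where "flips n s p q"
proof -
  consider i where "s = transpose i (i + 1) \<circ> transpose (- i) (- (i + 1))" "1 \<le> i" "i < int n"
    | "s = transpose 1 (- 1)" "0 < n"
    using assms by (auto simp: hyperoctahedral_group_gens_def split: if_splits)
  then show thesis using that flips_adjacent flips_sign by cases metis+
qed

lemma flips_comp_carrier:
  assumes "x \<in> carrier (hyperoctahedral_group n)" "flips n s p q"
  shows "x \<circ> s \<in> carrier (hyperoctahedral_group n)"
  using monoid.m_closed[OF group.is_monoid[OF group_hyperoctahedral_group], of x n s] assms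
  by (simp add: flips_def)

lemma flips_square: "flips n s p q \<Longrightarrow> s (s i) = i"
  unfolding flips_def by (metis comp_apply id_apply)

text \<open>Since \<open>s\<close> is an involution, the letter \<open>x i\<close> stands at
  position \<open>s i\<close> in \<open>x \<circ> s\<close>. Hence only pairs of positions inverted
  by \<open>s\<close> can change order.\<close>

lemma word_order_flip:
  assumes x: "x \<in> carrier (hyperoctahedral_group n)" and s: "flips n s p q"
  shows "word_order n x - word_order n (x \<circ> s) \<subseteq> {(x p, x q), (- x q, - x p)}"
proof
  fix e assume e: "e \<in> word_order n x - word_order n (x \<circ> s)"
  then obtain i j where ij: "e = (x i, x j)" "i \<in> signed_range n" "j \<in> signed_range n" "i < j"
    unfolding word_order_def by blast
  have sc: "s permutes signed_range n" using s hyperoctahedralD(1) unfolding flips_def by blast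
  have "\<not> s i < s j"
  proof
    assume "s i < s j"
    then have "((x \<circ> s) (s i), (x \<circ> s) (s j)) \<in> word_order n (x \<circ> s)"
      using word_order_iff[OF flips_comp_carrier[OF x s]] permutes_in_image[OF sc] ij by blast
    then show False using e ij flips_square[OF s] by simp
  qed
  then have "(i, j) = (p, q) \<or> (i, j) = (- q, - p)" using s ij unfolding flips_def by blast
  then show "e \<in> {(x p, x q), (- x q, - x p)}" using ij(1) hyperoctahedralD(2)[OF x] by auto
qed

lemma card_half_order_flip:
  assumes "x \<in> carrier (hyperoctahedral_group n)" "flips n s p q"
  shows "card (half_order n x - half_order n (x \<circ> s)) \<le> 1"
proof -
  \<comment> \<open>Of two mirror pairs only one has nonnegative sum, unless the sum is 0 and the
    pairs are equal.\<close>
  have "half_order n x - half_order n (x \<circ> s) \<subseteq>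
      {if 0 \<le> x p + x q then (x p, x q) else (- x q, - x p)}"
  proof (rule subrelI)
    fix a b assume "(a, b) \<in> half_order n x - half_order n (x \<circ> s)"
    then have pos: "0 \<le> a + b" and "(a, b) \<in> word_order n x - word_order n (x \<circ> s)"
      unfolding half_order_def by blast+
    then have "(a, b) = (x p, x q) \<or> (a, b) = (- x q, - x p)" using word_order_flip[OF assms] by blast
    then show "(a, b) \<in> {if 0 \<le> x p + x q then (x p, x q) else (- x q, - x p)}"
      using pos by auto
  qed
  from card_mono[OF _ this] show ?thesis by simp
qed

text \<open>The pair lost by the flip is wrong for \<open>y\<close>, and the reversed pair gained is
  right, so the difference strictly shrinks.\<close>

lemma half_order_flip_closer:
  assumes x: "x \<in> carrier (hyperoctahedral_group n)" and y: "y \<in> carrier (hyperoctahedral_group n)"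
    and s: "flips n s p q" and pq: "(x p, x q) \<notin> word_order n y"
  shows "card (half_order n (x \<circ> s) - half_order n y) < card (half_order n x - half_order n y)"
proof (rule psubset_card_mono)
  let ?xs = "x \<circ> s"
  have xs: "?xs \<in> carrier (hyperoctahedral_group n)" by (rule flips_comp_carrier[OF x s])
  have s': "p \<in> signed_range n" "q \<in> signed_range n" "p < q" "s p = q" "s q = p"
    using s flips_square[OF s, of p] unfolding flips_def by auto
  have xpq: "(x p, x q) \<in> word_order n x" using word_order_iff[OF x] s' by blast
  have "x p \<in> signed_range n" "x q \<in> signed_range n" "x p \<noteq> x q"
    using xpq word_order_subset[OF x] word_order_asym[OF x, of "x p" "x q"] by auto
  then have yqp: "(x q, x p) \<in> word_order n y" using word_order_total[OF y, of "x p" "x q"] pq by simp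
  \<comment> \<open>Flipping \<open>x \<circ> s\<close> gives back \<open>x\<close>, so
    \<open>word_order_flip\<close> also bounds the pairs gained.\<close>
  have "?xs \<circ> s = x" using flips_square[OF s] by (simp add: fun_eq_iff)
  then have diff: "word_order n ?xs - word_order n x \<subseteq> {(x q, x p), (- x p, - x q)}"
    using word_order_flip[OF xs s] s' by simp
  show "finite (half_order n x - half_order n y)" using finite_half_order[OF x] by blast
  have sub: "half_order n ?xs - half_order n y \<subseteq> half_order n x - half_order n y"
    using diff yqp word_order_minus[OF y yqp] unfolding half_order_def by blast
  define e where "e = (if 0 \<le> x p + x q then (x p, x q) else (- x q, - x p))"
  have "(x q, x p) \<in> word_order n ?xs"
    using word_order_iff[OF xs, of p q] s' by simp
  then have "(x p, x q) \<notin> word_order n ?xs" "(- x q, - x p) \<notin> word_order n ?xs"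
    using word_order_asym[OF xs] word_order_minus[OF xs] by (blast, blast)
  moreover have "(- x q, - x p) \<in> word_order n x" by (rule word_order_minus[OF x xpq])
  moreover have "(- x q, - x p) \<notin> word_order n y"
    using word_order_asym[OF y] word_order_minus[OF y yqp] by blast
  ultimately have "e \<in> half_order n x - half_order n y" "e \<notin> half_order n ?xs"
    using xpq pq unfolding half_order_def e_def by auto
  then show "half_order n ?xs - half_order n y \<subset> half_order n x - half_order n y" using sub by blast
qed

text \<open>Otherwise the inverse of \<open>y\<close> composed with \<open>x\<close> is odd,
  increasing on \<open>1..n\<close> and positive at 1, hence the identity.\<close>

lemma ex_misplaced_neighbours:
  assumes x: "x \<in> carrier (hyperoctahedral_group n)" and y: "y \<in> carrier (hyperoctahedral_group n)"
    and "x \<noteq> y"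
  shows "(\<exists>i. 1 \<le> i \<and> i < int n \<and> (x i, x (i + 1)) \<notin> word_order n y) \<or>
    0 < n \<and> (x (- 1), x 1) \<notin> word_order n y"
proof (rule ccontr)
  assume "\<not> ?thesis"
  then have step: "\<And>i. 1 \<le> i \<Longrightarrow> i < int n \<Longrightarrow> (x i, x (i + 1)) \<in> word_order n y"
    and sgn: "0 < n \<Longrightarrow> (x (- 1), x 1) \<in> word_order n y" by blast+
  note xD = hyperoctahedralD[OF x] and yD = hyperoctahedralD[OF y]
  define f where "f p = inv_into UNIV y (x p)" for p
  have yf: "y (f p) = x p" for p unfolding f_def by (rule permutes_inverses(1)[OF yD(1)])
  have f_less: "f p < f q \<and> f p \<in> signed_range n \<and> f q \<in> signed_range n" if "(x p, x q) \<in> word_order n y" for p q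
    using that word_order_iff[OF y, of "f p" "f q"] by (simp add: yf)
  have f_minus: "f (- p) = - f p" for p
    using yD(2)[of "f p"] by (metis yf xD(2) permutes_inj[OF yD(1)] injD)
  \<comment> \<open>The values are squeezed: strict growth from \<open>f 1 \<ge> 1\<close> bounds
    them below, and descending from \<open>f n \<le> n\<close> bounds them above.\<close>
  have low: "int k + 1 \<le> f (int k + 1)" if "k < n" for k
    using that
  proof (induction k)
    case 0
    then show ?case using f_less[OF sgn] f_minus[of 1] by simp
  next
    case (Suc k)
    then show ?case using f_less[OF step[of "int k + 1"]] by (simp add: algebra_simps)
  qed
  have high: "f (int n - int k) \<le> int n - int k" if "k < n" for k
    using that
  proof (induction k)
    case 0
    then have "int n \<in> signed_range n" by (simp add: signed_range_def)
    then have "f (int n) \<in> signed_range n"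
      unfolding f_def permutes_in_image[OF permutes_inv[OF yD(1)]] permutes_in_image[OF xD(1)] .
    then show ?case by (simp add: signed_range_def)
  next
    case (Suc k)
    then have "f (int n - int k - 1) < f (int n - int k)"
      using f_less[OF step[of "int n - int k - 1"]] by simp
    then show ?case using Suc by (simp add: algebra_simps)
  qed
  have pos: "x p = y p" if "1 \<le> p" "p \<le> int n" for p
  proof -
    have "nat (p - 1) < n" "nat (int n - p) < n" using that by linarith+
    from low[OF this(1)] high[OF this(2)] have "f p = p" using that by simp
    then show ?thesis using yf[of p] by simp
  qed
  have "x p = y p" for p
  proof (cases "p \<in> signed_range n")
    case True
    then show ?thesis
      using pos[of p] pos[of "- p"] xD(2)[of p] yD(2)[of p] by (cases "0 < p") (auto simp: signed_range_def)
  qed (use permutes_not_in xD(1) yD(1) in metis)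
  then show False using \<open>x \<noteq> y\<close> by blast
qed

lemma subset_word_orderI:
  assumes z: "z \<in> carrier (hyperoctahedral_group n)" and R: "sym_order R"
    and half: "\<And>a b. (a, b) \<in> R \<Longrightarrow> 0 \<le> a + b \<Longrightarrow> (a, b) \<in> half_order n z"
  shows "R \<subseteq> word_order n z"
proof (rule subrelI)
  fix a b assume ab: "(a, b) \<in> R"
  show "(a, b) \<in> word_order n z"
  proof (cases "0 \<le> a + b")
    case True
    then show ?thesis using half[OF ab] unfolding half_order_def by blast
  next
    case False
    then have "(- b, - a) \<in> word_order n z"
      using half[OF sym_orderD(3)[OF R ab]] unfolding half_order_def by simp
    from word_order_minus[OF z this] show ?thesis by simp
  qed
qed

text \<open>The upper inclusion follows from the lower one by totality: a pair of \<open>z\<close>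
  in neither \<open>u\<close> nor \<open>v\<close> is reversed in both, hence reversed in
  \<open>z\<close>.\<close>

lemma between_half_orderI:
  assumes "u \<in> carrier (hyperoctahedral_group n)" "v \<in> carrier (hyperoctahedral_group n)"
    "z \<in> carrier (hyperoctahedral_group n)" and r: "word_order n u \<inter> word_order n v \<subseteq> word_order n z"
  shows "half_order n u \<inter> half_order n v \<subseteq> half_order n z \<and>
      half_order n z \<subseteq> half_order n u \<union> half_order n v"
proof -
  have "(a, b) \<in> word_order n u \<union> word_order n v" if ab: "(a, b) \<in> word_order n z" for a b
  proof (rule ccontr)
    assume n: "(a, b) \<notin> word_order n u \<union> word_order n v"
    have "a \<in> signed_range n" "b \<in> signed_range n" "a \<noteq> b" "(b, a) \<notin> word_order n z"
      using ab word_order_subset[OF assms(3)] word_order_asym[OF assms(3)] by blast+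
    then show False using n r word_order_total assms(1,2) by blast
  qed
  then show ?thesis using r unfolding half_order_def by blast
qed

lemma card_half_order_Int_le:
  assumes "u \<in> carrier (hyperoctahedral_group n)" "v \<in> carrier (hyperoctahedral_group n)"
    "w \<in> carrier (hyperoctahedral_group n)"
  shows "card {z \<in> carrier (hyperoctahedral_group n).
      half_order n u \<inter> half_order n v \<inter> half_order n w \<subseteq> half_order n z} \<le>
    card {z \<in> carrier (hyperoctahedral_group n).
      half_order n u \<inter> half_order n v \<subseteq> half_order n z \<and> half_order n z \<subseteq> half_order n u \<union> half_order n v} *
    card {z \<in> carrier (hyperoctahedral_group n).
      half_order n v \<inter> half_order n w \<subseteq> half_order n z \<and> half_order n z \<subseteq> half_order n v \<union> half_order n w}"
proof -
  let ?B = "carrier (hyperoctahedral_group n)"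
  let ?W = "word_order n" and ?H = "half_order n"
  note fin = finite_hyperoctahedral[of n]
  have "?W u \<inter> ?W v \<inter> ?W w \<subseteq> ?W z" if "z \<in> ?B" "?H u \<inter> ?H v \<inter> ?H w \<subseteq> ?H z" for z
  proof (rule subset_word_orderI[OF that(1)])
    show "sym_order (?W u \<inter> ?W v \<inter> ?W w)"
      using assms sym_order_word_order sym_order_Int by blast
  qed (use that(2) in \<open>auto simp: half_order_def\<close>)
  then have "card {z \<in> ?B. ?H u \<inter> ?H v \<inter> ?H w \<subseteq> ?H z} \<le> card {z \<in> ?B. ?W u \<inter> ?W v \<inter> ?W w \<subseteq> ?W z}"
    using fin by (intro card_mono) auto
  also note card_word_order_Int_le[OF assms]
  also have "card {z \<in> ?B. ?W u \<inter> ?W v \<subseteq> ?W z} * card {z \<in> ?B. ?W v \<inter> ?W w \<subseteq> ?W z} \<le>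
      card {z \<in> ?B. ?H u \<inter> ?H v \<subseteq> ?H z \<and> ?H z \<subseteq> ?H u \<union> ?H v} *
      card {z \<in> ?B. ?H v \<inter> ?H w \<subseteq> ?H z \<and> ?H z \<subseteq> ?H v \<union> ?H w}"
    using fin between_half_orderI[OF assms(1,2)] between_half_orderI[OF assms(2,3)]
    by (intro mult_le_mono card_mono Collect_mono) simp_all
  finally show ?thesis .
qed

lemma cayley_graph_simps [simp]:
  "verts (cayley_graph W S) = carrier W"
  "(e \<in> arcs (cayley_graph W S)) = (case e of (x, y) \<Rightarrow> x \<in> carrier W \<and> y \<in> carrier W \<and>
      (\<exists>s\<in>S. y = x \<otimes>\<^bsub>W\<^esub> s \<or> x = y \<otimes>\<^bsub>W\<^esub> s))"
  "tail (cayley_graph W S) = fst" "head (cayley_graph W S) = snd"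
  by (auto simp: cayley_graph_def)

lemma flips_comp_comp: "flips n s p q \<Longrightarrow> (x \<circ> s) \<circ> s = x"
  by (simp add: fun_eq_iff flips_square)

lemma hypercube_embedding_hyperoctahedral:
  "hypercube_embedding (cayley_graph (hyperoctahedral_group n) (hyperoctahedral_group_gens n)) (half_order n)"
  (is "hypercube_embedding ?G _")
proof (intro hypercube_embedding.intro hypercube_embedding_axioms.intro wf_digraph_cayley_graph)
  show "finite (verts ?G)" by (simp add: finite_hyperoctahedral)
  show "finite (half_order n x)" if "x \<in> verts ?G" for x
    using that by (simp add: finite_half_order)
  show "card (half_order n (tail ?G e) - half_order n (head ?G e)) \<le> 1" if arc: "e \<in> arcs ?G" for e
  proof -
    obtain x y where e: "e = (x, y)" by (cases e)
    obtain s where xy: "x \<in> carrier (hyperoctahedral_group n)" "s \<in> hyperoctahedral_group_gens n"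
      "y = x \<circ> s \<or> x = y \<circ> s"
      using arc unfolding e cayley_graph_simps mult_hyperoctahedral by blast
    obtain p q where s: "flips n s p q" using xy(2) by (rule hyperoctahedral_gens_flips)
    have "y = x \<circ> s" using xy(3) flips_comp_comp[OF s] by metis
    then show ?thesis using card_half_order_flip[OF xy(1) s] by (simp add: e)
  qed
  fix x y assume "x \<in> verts ?G" "y \<in> verts ?G" and ne: "x \<noteq> y"
  then have xy: "x \<in> carrier (hyperoctahedral_group n)" "y \<in> carrier (hyperoctahedral_group n)"
    by simp_all
  obtain s p q where s: "s \<in> hyperoctahedral_group_gens n" "flips n s p q" "(x p, x q) \<notin> word_order n y"
    using ex_misplaced_neighbours[OF xy ne]
  proof (elim disjE exE conjE)
    fix i assume i: "1 \<le> i" "i < int n" "(x i, x (i + 1)) \<notin> word_order n y"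
    show thesis
      by (rule that[OF _ flips_adjacent[OF i(1,2)] i(3)])
        (use i in \<open>auto simp: hyperoctahedral_group_gens_def\<close>)
  next
    assume n: "0 < n" "(x (- 1), x 1) \<notin> word_order n y"
    show thesis
      by (rule that[OF _ flips_sign[OF n(1)] n(2)])
        (use n in \<open>simp add: hyperoctahedral_group_gens_def\<close>)
  qed
  then show "\<exists>e\<in>arcs ?G. tail ?G e = x \<and>
      card (half_order n (head ?G e) - half_order n y) < card (half_order n x - half_order n y)"
    using xy flips_comp_carrier[OF xy(1) s(2)] half_order_flip_closer[OF xy s(2,3)]
    by (intro bexI[of _ "(x, x \<circ> s)"]) auto
qed

lemma strong_hull_hyperoctahedral:
  "strong_hull_property (cayley_graph (hyperoctahedral_group n) (hyperoctahedral_group_gens n))"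
  by (rule hypercube_embedding.strong_hull_propertyI[OF hypercube_embedding_hyperoctahedral])
    (simp add: card_half_order_Int_le)

section \<open>The symmetric group\<close>

text \<open>Embeds the symmetric group as the elements of the hyperoctahedral group that place every
  negative letter before every positive one, so that type A follows from type B.\<close>

definition signed_ext :: "(nat \<Rightarrow> nat) \<Rightarrow> int \<Rightarrow> int" where
  "signed_ext x i = sgn i * int (x (nat \<bar>i\<bar>))"

context
  fixes n :: nat and x :: "nat \<Rightarrow> nat"
  assumes x: "x \<in> carrier (sym_group n)"
begin

lemma sym_group_permutes: "x permutes {1..n}"
  using x by (simp add: sym_group_def)

lemma sym_group_pos: "0 < x k \<longleftrightarrow> 0 < k"
proof -
  have "x k \<in> {1..n} \<longleftrightarrow> k \<in> {1..n}" by (rule permutes_in_image[OF sym_group_permutes])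
  then show ?thesis using permutes_not_in[OF sym_group_permutes, of k] by (cases "k \<in> {1..n}") auto
qed

lemma sgn_signed_ext: "sgn (signed_ext x i) = sgn i"
  using sym_group_pos[of "nat \<bar>i\<bar>"] 
  by (cases i "0 :: int" rule: linorder_cases) (simp_all add: signed_ext_def)

lemma abs_signed_ext: "nat \<bar>signed_ext x i\<bar> = x (nat \<bar>i\<bar>)"
  using sym_group_pos[of 0] by (cases "i = 0") (simp_all add: signed_ext_def abs_mult)

lemma signed_ext_carrier: "signed_ext x \<in> carrier (hyperoctahedral_group n)"
  unfolding carrier_hyperoctahedral
proof
  note xp = sym_group_permutes
  have mem: "i \<in> signed_range n \<longleftrightarrow> nat \<bar>i\<bar> \<in> {1..n}" for i
    by (auto simp: signed_range_def)
  have "inj (signed_ext x)"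
  proof (rule injI)
    fix i j assume eq: "signed_ext x i = signed_ext x j"
    have "x (nat \<bar>i\<bar>) = x (nat \<bar>j\<bar>)" using abs_signed_ext eq by metis
    then have "nat \<bar>i\<bar> = nat \<bar>j\<bar>" using permutes_inj[OF xp] by (simp add: inj_eq)
    moreover have "sgn i = sgn j" using sgn_signed_ext eq by metis
    ultimately show "i = j" by (metis abs_sgn mult_sgn_abs eq_nat_nat_iff abs_ge_zero)
  qed
  moreover have "signed_ext x ` signed_range n \<subseteq> signed_range n"
    unfolding image_subset_iff mem abs_signed_ext permutes_in_image[OF xp] using mem by blast
  ultimately have "bij_betw (signed_ext x) (signed_range n) (signed_range n)"
    using endo_inj_surj[OF signed_range(1)[of n]] by (metis bij_betw_def inj_on_subset subset_UNIV)
  then show "signed_ext x permutes signed_range n"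
  proof (rule bij_imp_permutes)
    fix i assume "i \<notin> signed_range n"
    then have "x (nat \<bar>i\<bar>) = nat \<bar>i\<bar>" using permutes_not_in[OF xp] mem by blast
    then show "signed_ext x i = i" by (simp add: signed_ext_def sgn_mult_abs)
  qed
qed (simp add: signed_ext_def sgn_minus)

lemma signed_ext_comp: "signed_ext (y \<circ> x) = signed_ext y \<circ> signed_ext x"
  using sgn_signed_ext abs_signed_ext by (simp add: fun_eq_iff signed_ext_def[of y] signed_ext_def[of "y \<circ> x"])

end

lemma signed_ext_inj:
  assumes "x \<in> carrier (sym_group n)" "y \<in> carrier (sym_group n)" "signed_ext x = signed_ext y"
  shows "x = y"
proof
  fix k
  show "x k = y k"
    using abs_signed_ext[OF assms(1), of "int k"] abs_signed_ext[OF assms(2), of "int k"] assms(3)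
    by simp
qed

lemma signed_ext_transpose:
  assumes "1 \<le> i"
  shows "signed_ext (transpose i (i + 1)) =
    transpose (int i) (int i + 1) \<circ> transpose (- int i) (- (int i + 1))"
proof
  fix j :: int
  have "nat \<bar>j\<bar> = i \<longleftrightarrow> j = int i \<or> j = - int i" "nat \<bar>j\<bar> = Suc i \<longleftrightarrow> j = int i + 1 \<or> j = - int i - 1"
    by auto
  then show "signed_ext (transpose i (i + 1)) j =
      (transpose (int i) (int i + 1) \<circ> transpose (- int i) (- (int i + 1))) j"
    using assms by (auto simp: signed_ext_def transpose_def sgn_if)
qed

lemma signed_ext_order:
  assumes "x \<in> carrier (sym_group n)" "a \<in> signed_range n" "b \<in> signed_range n" "a < 0" "0 < b"
  shows "(a, b) \<in> word_order n (signed_ext x)"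
proof -
  note c = signed_ext_carrier[OF assms(1)]
  obtain p where p: "p \<in> signed_range n" "a = signed_ext x p"
    using assms(2) by (rule signed_range_letter[OF c])
  obtain q where q: "q \<in> signed_range n" "b = signed_ext x q"
    using assms(3) by (rule signed_range_letter[OF c])
  have "p < 0" "0 < q"
    using assms(4,5) sgn_signed_ext[OF assms(1), of p] sgn_signed_ext[OF assms(1), of q] p q
    by (auto simp: sgn_if split: if_splits)
  then show ?thesis using word_order_iff[OF c] p q by simp
qed

text \<open>A negative letter \<open>z i\<close> at a position \<open>i > 0\<close> would have the
  positive letter \<open>z (- i)\<close> to its left, against \<open>ord\<close>. So
  \<open>z\<close> preserves signs and is determined by a permutation of
  \<open>1..n\<close>.\<close>

lemma signed_ext_image:
  assumes z: "z \<in> carrier (hyperoctahedral_group n)"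
    and ord: "\<And>a b. a \<in> signed_range n \<Longrightarrow> b \<in> signed_range n \<Longrightarrow> a < 0 \<Longrightarrow> 0 < b \<Longrightarrow>
      (a, b) \<in> word_order n z"
  shows "z \<in> signed_ext ` carrier (sym_group n)"
proof -
  note zD = hyperoctahedralD[OF z]
  have z0: "z 0 = 0" using zD(2)[of 0] by simp
  have pos: "0 < z i" if "0 < i" for i
  proof (cases "i \<in> signed_range n")
    case True
    show ?thesis
    proof (rule ccontr)
      assume "\<not> 0 < z i"
      moreover have zi: "z i \<in> signed_range n" using True permutes_in_image[OF zD(1)] by blast
      ultimately have "z i < 0" using signed_range(2)[of n] by (cases "z i = 0") auto
      then have "(z i, z (- i)) \<in> word_order n z"
        using ord[OF zi, of "- z i"] zi signed_range(3)[of "z i" n] zD(2)[of i] by simp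
      then show False using word_order_iff[OF z, of i "- i"] that by simp
    qed
  next
    case False
    then have "z i = i" by (rule permutes_not_in[OF zD(1)])
    then show ?thesis using that by simp
  qed
  define x where "x k = nat (z (int k))" for k
  have int_x: "int (x k) = z (int k)" for k
    using pos[of "int k"] z0 by (cases "k = 0") (simp_all add: x_def)
  have zx: "z = signed_ext x"
  proof
    fix i
    show "z i = signed_ext x i"
      using z0 zD(2)[of i] by (cases i "0 :: int" rule: linorder_cases) (simp_all add: signed_ext_def int_x)
  qed
  have mem: "int k \<in> signed_range n \<longleftrightarrow> k \<in> {1..n}" for k
    by (auto simp: signed_range_def)
  have "inj_on x {1..n}"
    by (rule inj_onI) (metis int_x permutes_inj[OF zD(1)] injD of_nat_eq_iff)
  moreover have "x ` {1..n} \<subseteq> {1..n}"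
    unfolding image_subset_iff mem[symmetric] int_x permutes_in_image[OF zD(1)] using mem by blast
  ultimately have "bij_betw x {1..n} {1..n}"
    using endo_inj_surj[of "{1..n}" x] by (simp add: bij_betw_def)
  then have "x permutes {1..n}"
  proof (rule bij_imp_permutes)
    fix k assume "k \<notin> {1..n}"
    then have "z (int k) = int k" using permutes_not_in[OF zD(1)] mem by blast
    then show "x k = k" by (simp add: x_def)
  qed
  then show ?thesis using zx by (simp add: sym_group_def)
qed

lemma hypercube_embedding_sym_group:
  "hypercube_embedding (cayley_graph (sym_group n) (sym_group_gens n)) (half_order n \<circ> signed_ext)"
  (is "hypercube_embedding ?G _")
proof (intro hypercube_embedding.intro hypercube_embedding_axioms.intro wf_digraph_cayley_graph)
  show "finite (verts ?G)"
    by (simp add: sym_group_def finite_permutations)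
  show "finite ((half_order n \<circ> signed_ext) x)" if "x \<in> verts ?G" for x
    using that by (simp add: finite_half_order signed_ext_carrier)
  have flip: "flips n (signed_ext s) (int i) (int i + 1)" "s \<circ> s = id" "s \<in> carrier (sym_group n)"
    if "s = transpose i (i + 1)" "1 \<le> i" "i < n" for s i
  proof -
    show "flips n (signed_ext s) (int i) (int i + 1)"
      unfolding that(1) signed_ext_transpose[OF that(2)] using that by (intro flips_adjacent) auto
    show "s \<circ> s = id" by (simp add: that(1))
    show "s \<in> carrier (sym_group n)" using that sym_group_gens_subset[of n] by (auto simp: sym_group_gens_def)
  qed
  show "card ((half_order n \<circ> signed_ext) (tail ?G e) - (half_order n \<circ> signed_ext) (head ?G e)) \<le> 1"
    if arc: "e \<in> arcs ?G" for e
  proof -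
    obtain x y where e: "e = (x, y)" by (cases e)
    obtain s i where xy: "x \<in> carrier (sym_group n)" "s = transpose i (i + 1)" "1 \<le> i" "i < n"
      "y = x \<circ> s \<or> x = y \<circ> s"
      using arc unfolding e cayley_graph_simps sym_group_mult sym_group_gens_def by blast
    have "y = x \<circ> s" using xy(5) flip(2)[OF xy(2-4)] by (metis comp_assoc comp_id)
    then show ?thesis
      using card_half_order_flip[OF signed_ext_carrier[OF xy(1)] flip(1)[OF xy(2-4)]]
      by (simp add: e signed_ext_comp[OF flip(3)[OF xy(2-4)]])
  qed
  fix x y assume "x \<in> verts ?G" "y \<in> verts ?G" and ne: "x \<noteq> y"
  then have xy: "x \<in> carrier (sym_group n)" "y \<in> carrier (sym_group n)"
    by simp_all
  note c = signed_ext_carrier[OF xy(1)] signed_ext_carrier[OF xy(2)]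
  \<comment> \<open>The sign change is never the misplaced step here, since embedded elements all
    put negative letters first. What remains is an adjacent transposition of the symmetric
    group.\<close>
  have "(signed_ext x (- 1), signed_ext x 1) \<in> word_order n (signed_ext y)" if "0 < n"
  proof (rule signed_ext_order[OF xy(2)])
    have "1 \<in> signed_range n" "- 1 \<in> signed_range n" using that by (auto simp: signed_range_def)
    then show "signed_ext x (- 1) \<in> signed_range n" "signed_ext x 1 \<in> signed_range n"
      using permutes_in_image[OF hyperoctahedralD(1)[OF c(1)]] by blast+
    show "signed_ext x (- 1) < 0" "0 < signed_ext x 1"
      using sgn_signed_ext[OF xy(1), of 1] sgn_signed_ext[OF xy(1), of "- 1"]
      by (auto simp: sgn_if split: if_splits)
  qed
  moreover have "signed_ext x \<noteq> signed_ext y" using ne signed_ext_inj[OF xy] by blast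
  ultimately obtain j where j: "1 \<le> j" "j < int n"
    "(signed_ext x j, signed_ext x (j + 1)) \<notin> word_order n (signed_ext y)"
    using ex_misplaced_neighbours[OF c] by blast
  define i s where "i = nat j" and "s = transpose i (i + 1)"
  have i: "1 \<le> i" "i < n" "j = int i" using j by (auto simp: i_def)
  note f = flip[OF s_def i(1,2)]
  have "x \<circ> s \<in> carrier (sym_group n)"
    using xy(1) f(3) by (simp add: sym_group_def permutes_compose)
  moreover have "s \<in> sym_group_gens n" using i by (auto simp: sym_group_gens_def s_def)
  ultimately show "\<exists>e\<in>arcs ?G. tail ?G e = x \<and>
      card ((half_order n \<circ> signed_ext) (head ?G e) - (half_order n \<circ> signed_ext) y) <
      card ((half_order n \<circ> signed_ext) x - (half_order n \<circ> signed_ext) y)"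
    using xy half_order_flip_closer[OF c f(1)] j(3) signed_ext_comp[OF f(3), of x]
    by (intro bexI[of _ "(x, x \<circ> s)"]) (auto simp: sym_group_mult i(3))
qed

lemma strong_hull_sym_group:
  "strong_hull_property (cayley_graph (sym_group n) (sym_group_gens n))"
proof (rule hypercube_embedding.strong_hull_propertyI[OF hypercube_embedding_sym_group])
  let ?A = "carrier (sym_group n)" and ?B = "carrier (hyperoctahedral_group n)"
  let ?H = "half_order n"
  fix u v w
  assume "u \<in> verts (cayley_graph (sym_group n) (sym_group_gens n))"
    "v \<in> verts (cayley_graph (sym_group n) (sym_group_gens n))"
    "w \<in> verts (cayley_graph (sym_group n) (sym_group_gens n))"
  then have uvw: "u \<in> ?A" "v \<in> ?A" "w \<in> ?A" by simp_all
  note c = signed_ext_carrier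
  have inj: "inj_on signed_ext ?A" using signed_ext_inj by (auto intro: inj_onI)
  \<comment> \<open>An interval of the hyperoctahedral group between embedded elements consists of
    embedded elements: negative letters precede positive ones in both ends, hence in
    \<open>z\<close>.\<close>
  have between: "card {z \<in> ?B. ?H (signed_ext s) \<inter> ?H (signed_ext t) \<subseteq> ?H z \<and>
        ?H z \<subseteq> ?H (signed_ext s) \<union> ?H (signed_ext t)} \<le>
      card {z \<in> ?A. ?H (signed_ext s) \<inter> ?H (signed_ext t) \<subseteq> ?H (signed_ext z) \<and>
        ?H (signed_ext z) \<subseteq> ?H (signed_ext s) \<union> ?H (signed_ext t)}"
    (is "card ?X \<le> card ?Y") if st: "s \<in> ?A" "t \<in> ?A" for s t
  proof -
    have "z \<in> signed_ext ` ?A" if z: "z \<in> ?X" for z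
    proof (rule signed_ext_image)
      show zB: "z \<in> ?B" using z by simp
      fix a b assume ab: "a \<in> signed_range n" "b \<in> signed_range n" "a < 0" "0 < b"
      have "word_order n (signed_ext s) \<inter> word_order n (signed_ext t) \<subseteq> word_order n z"
      proof (rule subset_word_orderI[OF zB])
        show "sym_order (word_order n (signed_ext s) \<inter> word_order n (signed_ext t))"
          by (intro sym_order_Int sym_order_word_order c st)
      qed (use z in \<open>auto simp: half_order_def\<close>)
      then show "(a, b) \<in> word_order n z" using signed_ext_order st ab by blast
    qed
    then have "?X \<subseteq> signed_ext ` ?Y" by blast
    moreover have "finite ?Y"
      by (simp add: sym_group_def finite_permutations)
    ultimately have "card ?X \<le> card (signed_ext ` ?Y)" "card (signed_ext ` ?Y) \<le> card ?Y"
      by (blast intro: card_mono, blast intro: card_image_le)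
    then show ?thesis by (rule le_trans)
  qed
  let ?U = "?H (signed_ext u)" and ?V = "?H (signed_ext v)" and ?W = "?H (signed_ext w)"
  \<comment> \<open>For the three-element side an injection into the hyperoctahedral group is
    enough.\<close>
  have "card {z \<in> ?A. ?U \<inter> ?V \<inter> ?W \<subseteq> ?H (signed_ext z)} \<le> card {z \<in> ?B. ?U \<inter> ?V \<inter> ?W \<subseteq> ?H z}"
  proof (rule card_inj_on_le)
    show "inj_on signed_ext {z \<in> ?A. ?U \<inter> ?V \<inter> ?W \<subseteq> ?H (signed_ext z)}"
      using inj by (rule inj_on_subset) blast
  qed (use c finite_hyperoctahedral in auto)
  also note card_half_order_Int_le[OF c[OF uvw(1)] c[OF uvw(2)] c[OF uvw(3)]]
  also note mult_le_mono[OF between[OF uvw(1,2)] between[OF uvw(2,3)]]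
  finally show "card {z \<in> verts (cayley_graph (sym_group n) (sym_group_gens n)).
        (?H \<circ> signed_ext) u \<inter> (?H \<circ> signed_ext) v \<inter> (?H \<circ> signed_ext) w \<subseteq> (?H \<circ> signed_ext) z} \<le>
      card {z \<in> verts (cayley_graph (sym_group n) (sym_group_gens n)).
        (?H \<circ> signed_ext) u \<inter> (?H \<circ> signed_ext) v \<subseteq> (?H \<circ> signed_ext) z \<and>
        (?H \<circ> signed_ext) z \<subseteq> (?H \<circ> signed_ext) u \<union> (?H \<circ> signed_ext) v} *
      card {z \<in> verts (cayley_graph (sym_group n) (sym_group_gens n)).
        (?H \<circ> signed_ext) v \<inter> (?H \<circ> signed_ext) w \<subseteq> (?H \<circ> signed_ext) z \<and>
        (?H \<circ> signed_ext) z \<subseteq> (?H \<circ> signed_ext) v \<union> (?H \<circ> signed_ext) w}"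
    by simp
qed

theorem theorem1p4:
  fixes n :: nat
  shows "strong_hull_property (cayley_graph (sym_group n) (sym_group_gens n)) \<and>
         strong_hull_property
           (cayley_graph (hyperoctahedral_group n) (hyperoctahedral_group_gens n))"
  using strong_hull_sym_group strong_hull_hyperoctahedral by blast

end
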